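(* Every TIS state for the SSM (stack) dynamics with density $\hat\rho>1$ is supported on $\widehat X^*$; equivalently, every TIS state for the F-SSEP dynamics with density $\rho>1/2$ is supported on $H$.
   Context: F-SSEP: the discrete-time Markov process on $X=\{0,1\}^{\mathbb Z}$ in which, in passing from $\eta_t$ to $\eta_{t+1}$, every particle (site $i$ with $\eta_t(i)=1$) with exactly one occupied neighboring site attempts to jump to its empty neighboring site; the jump takes place unless two particles attempt to jump to the same site, in which case one of the two, chosen with probability $1/2$ each (independently for different sites), succeeds. SSM (symmetric stack model): the discrete-time Markov process on $\widehat X=\mathbb Z_+^{\mathbb Z}$, $\mathbb Z_+=\{0,1,2,\dots\}$. A stack $\mathbf n(i)$ is short if $\mathbf n(i)\le1$ and tall otherwise. In passing from $\mathbf n_t$ to $\mathbf n_{t+1}$, simultaneously for each bond $\langle k,k+1\rangle$: if both stacks are short no particle crosses the bond; if one is short and one tall, one particle moves from the tall to the short stack; if both are tall, one particle moves across the bond in a direction chosen with probability $1/2$ each (independently for different bonds). States are Borel probability measures. TIS = translation invariant and stationary for the dynamics. A translation invariant state has density $\rho$ if almost every configuration $\eta$ satisfies $\lim_{N}\frac1N\sum_{i=1}^N\eta(i)=\lim_{N}\frac1N\sum_{i=-N}^{-1}\eta(i)=\rho$ (similarly for the SSM with density $\hat\rho<\infty$). $\widehat X^*\subset\widehat X$ is the set of configurations for which no two adjacent sites both have short stacks. $H\subset X$ is the set of configurations which do not contain any of the substrings $000$, $0100$, $0010$, and $01010$. *)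

theory Defs
  imports "HOL-Probability.Probability"
begin

instance bool :: second_countable_topology
proof
  show "\<exists>B::bool set set. countable B \<and> open = generate_topology B"
  proof (intro exI conjI)
    show "countable (UNIV :: bool set set)" by (rule countable_finite) simp
    have "generate_topology UNIV S" for S :: "bool set" by (rule generate_topology.Basis) simp
    then show "open = generate_topology (UNIV :: bool set set)"
      by (intro ext) (simp add: discrete_topology_class.open_discrete)
  qed
qed

text \<open>Configurations are functions on \<^typ>\<open>int\<close>; \<^term>\<open>borel\<close> is the Borel sigma-algebra of the
  product of the discrete topologies on the sites.\<close>

definition state :: "'a::topological_space measure \<Rightarrow> bool" where
  "state \<mu> \<longleftrightarrow> prob_space \<mu> \<and> sets \<mu> = sets borel"

definition translation_invariant :: "(int \<Rightarrow> 'a::topological_space) measure \<Rightarrow> bool" where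
  "translation_invariant \<mu> \<longleftrightarrow> (\<forall>k. distr \<mu> borel (\<lambda>\<eta> i. \<eta> (i + k)) = \<mu>)"

definition stationary :: "('a \<Rightarrow> 'a measure) \<Rightarrow> 'a measure \<Rightarrow> bool" where
  "stationary K \<mu> \<longleftrightarrow> \<mu> \<bind> K = \<mu>"

definition TIS ::
  "((int \<Rightarrow> 'a::topological_space) \<Rightarrow> (int \<Rightarrow> 'a) measure) \<Rightarrow> (int \<Rightarrow> 'a) measure \<Rightarrow> bool" where
  "TIS K \<mu> \<longleftrightarrow> state \<mu> \<and> translation_invariant \<mu> \<and> stationary K \<mu>"

text \<open>The density is measured through an occupation number \<open>occ\<close>, which is \<^term>\<open>of_bool\<close> for the
  F-SSEP and \<^term>\<open>real\<close> for the stack model.\<close>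

definition config_density :: "('a \<Rightarrow> real) \<Rightarrow> (int \<Rightarrow> 'a) \<Rightarrow> real \<Rightarrow> bool" where
  "config_density occ \<eta> \<rho> \<longleftrightarrow>
     (\<lambda>N::nat. (\<Sum>i = 1..int N. occ (\<eta> i)) / real N) \<longlonglongrightarrow> \<rho> \<and>
     (\<lambda>N::nat. (\<Sum>i = - int N..- 1. occ (\<eta> i)) / real N) \<longlonglongrightarrow> \<rho>"

definition has_density :: "('a \<Rightarrow> real) \<Rightarrow> (int \<Rightarrow> 'a) measure \<Rightarrow> real \<Rightarrow> bool" where
  "has_density occ \<mu> \<rho> \<longleftrightarrow> (AE \<eta> in \<mu>. config_density occ \<eta> \<rho>)"

definition supported_on :: "'a measure \<Rightarrow> 'a set \<Rightarrow> bool" where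
  "supported_on \<mu> A \<longleftrightarrow> (AE \<eta> in \<mu>. \<eta> \<in> A)"

text \<open>One time step uses an independent fair coin for every site (F-SSEP) or bond (stack model);
  coins that are not needed are ignored.\<close>

definition coins :: "(int \<Rightarrow> bool) measure" where
  "coins = (\<Pi>\<^sub>M i\<in>UNIV. measure_pmf (bernoulli_pmf (1/2)))"

definition attempts_right :: "(int \<Rightarrow> bool) \<Rightarrow> int \<Rightarrow> bool" where
  "attempts_right \<eta> i \<longleftrightarrow> \<eta> i \<and> \<eta> (i - 1) \<and> \<not> \<eta> (i + 1)"

definition attempts_left :: "(int \<Rightarrow> bool) \<Rightarrow> int \<Rightarrow> bool" where
  "attempts_left \<eta> i \<longleftrightarrow> \<eta> i \<and> \<eta> (i + 1) \<and> \<not> \<eta> (i - 1)"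

text \<open>If the particles at \<open>j - 1\<close> and \<open>j + 1\<close> both attempt to jump to \<open>j\<close>, the left one succeeds
  iff \<open>\<omega> j\<close>.\<close>

definition jumps_right :: "(int \<Rightarrow> bool) \<Rightarrow> (int \<Rightarrow> bool) \<Rightarrow> int \<Rightarrow> bool" where
  "jumps_right \<omega> \<eta> i \<longleftrightarrow> attempts_right \<eta> i \<and> (attempts_left \<eta> (i + 2) \<longrightarrow> \<omega> (i + 1))"

definition jumps_left :: "(int \<Rightarrow> bool) \<Rightarrow> (int \<Rightarrow> bool) \<Rightarrow> int \<Rightarrow> bool" where
  "jumps_left \<omega> \<eta> i \<longleftrightarrow> attempts_left \<eta> i \<and> (attempts_right \<eta> (i - 2) \<longrightarrow> \<not> \<omega> (i - 1))"

definition fssep_step :: "(int \<Rightarrow> bool) \<Rightarrow> (int \<Rightarrow> bool) \<Rightarrow> (int \<Rightarrow> bool)" where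
  "fssep_step \<omega> \<eta> = (\<lambda>i.
     \<eta> i \<and> \<not> jumps_right \<omega> \<eta> i \<and> \<not> jumps_left \<omega> \<eta> i \<or>
     jumps_right \<omega> \<eta> (i - 1) \<or> jumps_left \<omega> \<eta> (i + 1))"

definition fssep_kernel :: "(int \<Rightarrow> bool) \<Rightarrow> (int \<Rightarrow> bool) measure" where
  "fssep_kernel \<eta> = distr coins borel (\<lambda>\<omega>. fssep_step \<omega> \<eta>)"

definition contains_substring :: "(int \<Rightarrow> bool) \<Rightarrow> nat list \<Rightarrow> bool" where
  "contains_substring \<eta> w \<longleftrightarrow> (\<exists>i. \<forall>j < length w. of_bool (\<eta> (i + int j)) = w ! j)"

definition H :: "(int \<Rightarrow> bool) set" where
  "H = {\<eta>. \<forall>w \<in> {[0,0,0], [0,1,0,0], [0,0,1,0], [0,1,0,1,0]}. \<not> contains_substring \<eta> w}"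

abbreviation short :: "nat \<Rightarrow> bool" where
  "short m \<equiv> m \<le> 1"

text \<open>Net number of particles crossing the bond between \<open>k\<close> and \<open>k + 1\<close> to the right.\<close>

definition ssm_current :: "(int \<Rightarrow> bool) \<Rightarrow> (int \<Rightarrow> nat) \<Rightarrow> int \<Rightarrow> int" where
  "ssm_current \<omega> n k =
     (if short (n k) \<and> short (n (k + 1)) then 0
      else if short (n k) then - 1
      else if short (n (k + 1)) then 1
      else if \<omega> k then 1 else - 1)"

text \<open>The argument of \<^term>\<open>nat\<close> is never negative, see \<open>ssm_step_int\<close> below.\<close>

definition ssm_step :: "(int \<Rightarrow> bool) \<Rightarrow> (int \<Rightarrow> nat) \<Rightarrow> (int \<Rightarrow> nat)" where
  "ssm_step \<omega> n = (\<lambda>k. nat (int (n k) + ssm_current \<omega> n (k - 1) - ssm_current \<omega> n k))"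

definition ssm_kernel :: "(int \<Rightarrow> nat) \<Rightarrow> (int \<Rightarrow> nat) measure" where
  "ssm_kernel n = distr coins borel (\<lambda>\<omega>. ssm_step \<omega> n)"

definition X_hat_star :: "(int \<Rightarrow> nat) set" where
  "X_hat_star = {n. \<forall>i. \<not> (short (n i) \<and> short (n (i + 1)))}"

lemma ssm_step_int:
  "int (ssm_step \<omega> n k) = int (n k) + ssm_current \<omega> n (k - 1) - ssm_current \<omega> n k"
  by (auto simp: ssm_step_def ssm_current_def)

lemma sets_borel_config:
  "sets (borel :: (int \<Rightarrow> 'a::{countable,second_countable_topology,t2_space}) measure) =
     sets (\<Pi>\<^sub>M i\<in>UNIV. count_space UNIV)"
  by (subst sets_PiM_equal_borel[symmetric], rule sets_PiM_cong)
     (auto simp: sets_borel_eq_count_space)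

lemma sets_coins: "sets coins = sets borel"
  unfolding coins_def sets_borel_config by (rule sets_PiM_cong) auto

lemma prob_space_coins: "prob_space coins"
  unfolding coins_def by (rule prob_space_PiM) (rule prob_space_measure_pmf)

lemma measurable_site:
  "(\<lambda>\<eta> :: int \<Rightarrow> 'a::{countable,second_countable_topology,t2_space}. \<eta> i)
     \<in> borel \<rightarrow>\<^sub>M count_space UNIV"
  by (subst measurable_cong_sets[OF sets_borel_config refl]) measurable

lemma measurable_site_comp:
  fixes f :: "'b \<Rightarrow> int \<Rightarrow> 'a::{countable,second_countable_topology,t2_space}"
  assumes "f \<in> M \<rightarrow>\<^sub>M borel"
  shows "(\<lambda>x. f x i) \<in> M \<rightarrow>\<^sub>M count_space UNIV"
  using measurable_compose[OF assms measurable_site] .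

lemma measurable_configI:
  fixes f :: "'b \<Rightarrow> int \<Rightarrow> 'a::{countable,second_countable_topology,t2_space}"
  assumes "\<And>i. (\<lambda>x. f x i) \<in> M \<rightarrow>\<^sub>M count_space UNIV"
  shows "f \<in> M \<rightarrow>\<^sub>M borel"
  by (subst measurable_cong_sets[OF refl sets_borel_config], rule measurable_PiM_single')
     (use assms in auto)

lemma measurable_comp3:
  fixes f :: "'b \<Rightarrow> 'c::countable" and g :: "'b \<Rightarrow> 'd::countable" and h :: "'b \<Rightarrow> 'e::countable"
  assumes f: "f \<in> M \<rightarrow>\<^sub>M count_space UNIV" and g: "g \<in> M \<rightarrow>\<^sub>M count_space UNIV"
    and h: "h \<in> M \<rightarrow>\<^sub>M count_space UNIV"
  shows "(\<lambda>x. c (f x) (g x) (h x)) \<in> M \<rightarrow>\<^sub>M count_space UNIV"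
proof (rule measurable_compose_countable[OF _ h])
  fix w
  show "(\<lambda>x. c (f x) (g x) w) \<in> M \<rightarrow>\<^sub>M count_space UNIV"
  proof (rule measurable_compose_countable[OF _ g])
    fix v
    show "(\<lambda>x. c (f x) v w) \<in> M \<rightarrow>\<^sub>M count_space UNIV"
      using measurable_compose[OF f, of "\<lambda>u. c u v w"] by simp
  qed
qed

lemma measurable_fssep_step:
  "(\<lambda>(\<eta>, \<omega>). fssep_step \<omega> \<eta>) \<in> borel \<Otimes>\<^sub>M borel \<rightarrow>\<^sub>M borel"
proof -
  let ?M = "borel \<Otimes>\<^sub>M borel :: ((int \<Rightarrow> bool) \<times> (int \<Rightarrow> bool)) measure"
  have site: "(\<lambda>x. fst x i) \<in> ?M \<rightarrow>\<^sub>M count_space UNIV" "(\<lambda>x. snd x i) \<in> ?M \<rightarrow>\<^sub>M count_space UNIV" for i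
    by (rule measurable_site_comp, simp)+
  have right: "(\<lambda>x. attempts_right (fst x) i) \<in> ?M \<rightarrow>\<^sub>M count_space UNIV" for i
    unfolding attempts_right_def
    by (rule measurable_comp3[OF site(1) site(1) site(1), where c = "\<lambda>a b c. a \<and> b \<and> \<not> c"])
  have left: "(\<lambda>x. attempts_left (fst x) i) \<in> ?M \<rightarrow>\<^sub>M count_space UNIV" for i
    unfolding attempts_left_def
    by (rule measurable_comp3[OF site(1) site(1) site(1), where c = "\<lambda>a b c. a \<and> b \<and> \<not> c"])
  have jright: "(\<lambda>x. jumps_right (snd x) (fst x) i) \<in> ?M \<rightarrow>\<^sub>M count_space UNIV" for i
    unfolding jumps_right_def
    by (rule measurable_comp3[OF right left site(2), where c = "\<lambda>a b c. a \<and> (b \<longrightarrow> c)"])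
  have jleft: "(\<lambda>x. jumps_left (snd x) (fst x) i) \<in> ?M \<rightarrow>\<^sub>M count_space UNIV" for i
    unfolding jumps_left_def
    by (rule measurable_comp3[OF left right site(2), where c = "\<lambda>a b c. a \<and> (b \<longrightarrow> \<not> c)"])
  have stay: "(\<lambda>x. fst x i \<and> \<not> jumps_right (snd x) (fst x) i \<and> \<not> jumps_left (snd x) (fst x) i)
      \<in> ?M \<rightarrow>\<^sub>M count_space UNIV" for i
    by (rule measurable_comp3[OF site(1) jright jleft, where c = "\<lambda>a b c. a \<and> \<not> b \<and> \<not> c"])
  show ?thesis
    unfolding fssep_step_def case_prod_beta
    by (rule measurable_configI)
       (rule measurable_comp3[OF stay jright jleft, where c = "\<lambda>a b c. a \<or> b \<or> c"])
qed

lemma measurable_ssm_step: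
  "(\<lambda>(n, \<omega>). ssm_step \<omega> n) \<in> borel \<Otimes>\<^sub>M borel \<rightarrow>\<^sub>M borel"
proof -
  let ?M = "borel \<Otimes>\<^sub>M borel :: ((int \<Rightarrow> nat) \<times> (int \<Rightarrow> bool)) measure"
  have site: "(\<lambda>x. fst x i) \<in> ?M \<rightarrow>\<^sub>M count_space UNIV" "(\<lambda>x. snd x i) \<in> ?M \<rightarrow>\<^sub>M count_space UNIV" for i
    by (rule measurable_site_comp, simp)+
  have current: "(\<lambda>x. ssm_current (snd x) (fst x) k) \<in> ?M \<rightarrow>\<^sub>M count_space UNIV" for k
    unfolding ssm_current_def
    by (rule measurable_comp3[OF site(1) site(1) site(2), where c = "\<lambda>a b w.
          if short a \<and> short b then 0 else if short a then - 1 else if short b then 1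
          else if w then 1 else - 1"])
  show ?thesis
    unfolding ssm_step_def case_prod_beta
    by (rule measurable_configI)
       (rule measurable_comp3[OF site(1) current current, where c = "\<lambda>a b c. nat (int a + b - c)"])
qed

lemma kernel_prob_algebra:
  fixes step :: "(int \<Rightarrow> bool) \<Rightarrow> 'a::topological_space \<Rightarrow> 'a"
  assumes "(\<lambda>(x, \<omega>). step \<omega> x) \<in> borel \<Otimes>\<^sub>M borel \<rightarrow>\<^sub>M borel"
  shows "(\<lambda>x. distr coins borel (\<lambda>\<omega>. step \<omega> x)) \<in> borel \<rightarrow>\<^sub>M prob_algebra borel"
proof -
  have "coins \<in> space (prob_algebra borel)"
    by (simp add: space_prob_algebra sets_coins prob_space_coins)
  then show ?thesis
    by (intro measurable_distr_prob_space2[where M = borel]) (use assms in auto)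
qed

lemma measurable_fssep_kernel: "fssep_kernel \<in> borel \<rightarrow>\<^sub>M prob_algebra borel"
  unfolding fssep_kernel_def by (rule kernel_prob_algebra) (rule measurable_fssep_step)

lemma measurable_ssm_kernel: "ssm_kernel \<in> borel \<rightarrow>\<^sub>M prob_algebra borel"
  unfolding ssm_kernel_def by (rule kernel_prob_algebra) (rule measurable_ssm_step)

end

theory Submission
  imports Defs
begin

text \<open>
  Let \<open>h\<close> be a height function of a stack configuration \<open>n\<close>, so \<open>h k - h (k - 1) = n k - 1\<close>. The
  dynamics lower or raise \<open>h\<close> by one at every bond, except that bonds between two short stacks are
  frozen. A maximal run of at least two short stacks moves its ends by at most one per step and no
  new run is ever created. By mass transport a stationary translation invariant state therefore
  neither destroys nor merges runs, and then it does not destroy empty stacks in the interior of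
  runs either. As every pattern of finitely many coins has positive probability, all this holds for
  every configuration in the support and every choice of coins.

  If the density exceeds 1, the height tends to \<open>-\<infinity>\<close> on the left and to \<open>\<infinity>\<close> on the right. Given a
  frozen bond at is_height \<open>h0\<close>, consider the leftmost run up to this bond that reaches is_height \<open>h0\<close> and
  the rightmost run from this bond on that goes down to \<open>h0\<close>. Steering all particles towards these two
  runs moves the left end of the first one and the right end of the second one towards each other
  without bound, which is impossible since ends persist.

  In the exclusion process, the particles between consecutive holes form the stacks; the position of
  hole \<open>k + 1\<close> minus \<open>2 k\<close> is a height function.
\<close>

section \<open>Runs of short stacks\<close>

definition frozen :: "(int \<Rightarrow> nat) \<Rightarrow> int \<Rightarrow> bool" where
  "frozen n k \<longleftrightarrow> short (n k) \<and> short (n (k + 1))"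

text \<open>Marks the left end of a maximal run of at least two short stacks; right ends are treated
  as run starts of \<open>reflect n\<close>.\<close>

definition run_start :: "(int \<Rightarrow> nat) \<Rightarrow> int \<Rightarrow> bool" where
  "run_start n k \<longleftrightarrow> \<not> short (n (k - 1)) \<and> short (n k) \<and> short (n (k + 1))"

definition inner_zero :: "(int \<Rightarrow> nat) \<Rightarrow> int \<Rightarrow> bool" where
  "inner_zero n k \<longleftrightarrow> n k = 0 \<and> short (n (k - 1)) \<and> short (n (k + 1))"

definition reflect :: "(int \<Rightarrow> 'a) \<Rightarrow> int \<Rightarrow> 'a" where
  "reflect n k = n (- k)"

lemma step_at:
  "int (ssm_step \<omega> n j) = int (n j) + ssm_current \<omega> n (j - 1) - ssm_current \<omega> n j"
  "int (ssm_step \<omega> n (j - 1)) = int (n (j - 1)) + ssm_current \<omega> n (j - 2) - ssm_current \<omega> n (j - 1)"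
  "int (ssm_step \<omega> n (j + 1)) = int (n (j + 1)) + ssm_current \<omega> n j - ssm_current \<omega> n (j + 1)"
  using ssm_step_int[of \<omega> n j] ssm_step_int[of \<omega> n "j - 1"] ssm_step_int[of \<omega> n "j + 1"] by auto

lemma current_cases:
  obtains "short (n k)" "short (n (k + 1))" "ssm_current \<omega> n k = 0"
  | "\<not> short (n k)" "ssm_current \<omega> n k = 1"
  | "\<not> short (n (k + 1))" "ssm_current \<omega> n k = - 1"
  unfolding ssm_current_def by (metis (full_types))

lemma current_frozen: "frozen n k \<Longrightarrow> ssm_current \<omega> n k = 0"
  by (simp add: frozen_def ssm_current_def)

lemma current_tall_short: "\<not> short (n k) \<Longrightarrow> short (n (k + 1)) \<Longrightarrow> ssm_current \<omega> n k = 1"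
  by (simp add: ssm_current_def)

lemma current_short_tall: "short (n k) \<Longrightarrow> \<not> short (n (k + 1)) \<Longrightarrow> ssm_current \<omega> n k = - 1"
  by (simp add: ssm_current_def)

lemma current_range: "ssm_current \<omega> n k \<in> {- 1, 0, 1}"
  by (simp add: ssm_current_def)

text \<open>A tall stack sends a particle to its short neighbour, which stays short only if it was
  empty and gains nothing from its other side, so that the bond on that side was frozen. Two
  adjacent tall stacks cannot both become short: the one that wins the particle across their bond
  loses at most one elsewhere.\<close>

lemma frozen_step_cases:
  assumes "frozen (ssm_step \<omega> n) k"
  obtains "frozen n k"
  | "\<not> short (n k)" "n (k + 1) = 0" "frozen n (k + 1)" "ssm_step \<omega> n (k + 1) = 1"
  | "\<not> short (n (k + 1))" "n k = 0" "frozen n (k - 1)" "ssm_step \<omega> n k = 1"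
proof -
  have s: "short (ssm_step \<omega> n k)" "short (ssm_step \<omega> n (k + 1))"
    using assms by (auto simp: frozen_def)
  have r: "ssm_current \<omega> n (k - 1) \<in> {- 1, 0, 1}" "ssm_current \<omega> n (k + 1) \<in> {- 1, 0, 1}"
    by (rule current_range)+
  consider "short (n k)" "short (n (k + 1))" | "\<not> short (n k)" "short (n (k + 1))"
    | "short (n k)" "\<not> short (n (k + 1))" | "\<not> short (n k)" "\<not> short (n (k + 1))" by blast
  then show thesis
  proof cases
    case 1
    then show ?thesis using that(1) by (simp add: frozen_def)
  next
    case 2
    have c: "ssm_current \<omega> n k = 1" using 2 by (rule current_tall_short)
    have e: "short (n (k + 1 + 1))" 
    proof (rule ccontr)
      assume "\<not> ?thesis"
      with 2 have "ssm_current \<omega> n (k + 1) = - 1" by (intro current_short_tall) auto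
      with c step_at(3)[of \<omega> n k] s(2) show False by linarith
    qed
    then have "ssm_current \<omega> n (k + 1) = 0" using 2 by (intro current_frozen) (simp add: frozen_def)
    with c step_at(3)[of \<omega> n k] s(2) have "n (k + 1) = 0" "ssm_step \<omega> n (k + 1) = 1" by linarith+
    with 2 e that(2) show ?thesis by (simp add: frozen_def)
  next
    case 3
    have c: "ssm_current \<omega> n k = - 1" using 3 by (rule current_short_tall)
    have e: "short (n (k - 1))" 
    proof (rule ccontr)
      assume "\<not> ?thesis"
      with 3 have "ssm_current \<omega> n (k - 1) = 1" by (intro current_tall_short) auto
      with c step_at(1)[of \<omega> n k] s(1) show False by linarith
    qed
    then have "ssm_current \<omega> n (k - 1) = 0" using 3 by (intro current_frozen) (simp add: frozen_def)
    with c step_at(1)[of \<omega> n k] s(1) have "n k = 0" "ssm_step \<omega> n k = 1" by linarith+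
    with 3 e that(3) show ?thesis by (simp add: frozen_def)
  next
    case 4
    then have "ssm_current \<omega> n k = 1 \<or> ssm_current \<omega> n k = - 1" by (simp add: ssm_current_def)
    with step_at(1)[of \<omega> n k] step_at(3)[of \<omega> n k] s 4 r show ?thesis by auto
  qed
qed

lemma short_becomes_tall:
  assumes "short (n k)" "short (n (k + 1))" "\<not> short (ssm_step \<omega> n k)"
  shows "n k = 1" "\<not> short (n (k - 1))"
proof -
  have "ssm_current \<omega> n k = 0" using assms by (intro current_frozen) (simp add: frozen_def)
  with assms step_at(1)[of \<omega> n k] have "ssm_current \<omega> n (k - 1) > 0" by linarith
  with current_cases[of n "k - 1" \<omega>] have "\<not> short (n (k - 1))" "ssm_current \<omega> n (k - 1) = 1" by force+
  with assms step_at(1)[of \<omega> n k] \<open>ssm_current \<omega> n k = 0\<close>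
  show "n k = 1" "\<not> short (n (k - 1))" by linarith+
qed

text \<open>Origin of run starts, fed to \<open>marker_persists\<close>: a bond that becomes frozen
  extends an adjacent run, so no start appears far from an old one.\<close>

lemma run_start_step:
  assumes "run_start (ssm_step \<omega> n) j"
  shows "\<exists>i. \<bar>i - j\<bar> \<le> 1 \<and> run_start n i"
proof -
  have t: "\<not> short (ssm_step \<omega> n (j - 1))" and f: "frozen (ssm_step \<omega> n) j"
    using assms by (auto simp: run_start_def frozen_def)
  \<comment> \<open>If the stack before \<open>j\<close> was short and has become tall, it was
    filled from a tall stack on its left, hence started the run.\<close>
  have prev: "run_start n (j - 1)" if "short (n (j - 1))" "short (n j)"
    using short_becomes_tall[of n "j - 1" \<omega>] t that by (simp add: run_start_def)
  from f show ?thesis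
  proof (cases rule: frozen_step_cases)
    case 1
    then show ?thesis using prev
      by (cases "short (n (j - 1))") (auto simp: run_start_def frozen_def intro: exI[of _ j] exI[of _ "j - 1"])
  next
    case 2
    then show ?thesis by (intro exI[of _ "j + 1"]) (simp add: run_start_def frozen_def)
  next
    case 3
    then show ?thesis using prev by (intro exI[of _ "j - 1"]) (simp add: frozen_def)
  qed
qed

text \<open>More than twice the displacement 1 of \<open>run_start_step\<close>, so no old start
  lies within reach of two new ones.\<close>

lemma run_start_spacing:
  assumes "run_start n i" "run_start n j" "i \<noteq> j"
  shows "\<bar>i - j\<bar> > 2"
proof (rule ccontr)
  assume "\<not> ?thesis"
  with assms(3) have "j = i + 1 \<or> j = i + 2 \<or> j = i - 1 \<or> j = i - 2" by linarith
  with assms show False by (auto simp: run_start_def algebra_simps)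
qed

text \<open>The only way to create an inner zero is to merge two runs.\<close>

lemma inner_zero_step:
  assumes z: "inner_zero (ssm_step \<omega> n) k"
    and persist: "\<And>i. run_start n i \<Longrightarrow> \<exists>j. \<bar>j - i\<bar> \<le> 1 \<and> run_start (ssm_step \<omega> n) j"
  shows "inner_zero n k"
proof -
  let ?n' = "ssm_step \<omega> n"
  have s: "?n' k = 0" "frozen ?n' k" "frozen ?n' (k - 1)"
    using z by (auto simp: inner_zero_def frozen_def)
  from s(2) show ?thesis
  proof (cases rule: frozen_step_cases)
    case 3
    then show ?thesis using s by simp
  next
    case A: 1
    from s(3) show ?thesis
    proof (cases rule: frozen_step_cases)
      case 1
      have "ssm_current \<omega> n k = 0" "ssm_current \<omega> n (k - 1) = 0"
        using A 1 by (auto intro: current_frozen)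
      with step_at(1)[of \<omega> n k] s(1) have "n k = 0" by linarith
      with 1 A show ?thesis by (auto simp: inner_zero_def frozen_def)
    next
      case 2
      with s show ?thesis by simp
    next
      case 3
      with A show ?thesis by (simp add: frozen_def)
    qed
  next
    \<comment> \<open>Bond \<open>k\<close> was not frozen, so a run started at
      \<open>k + 1\<close>. It would persist as a start at \<open>k\<close>, \<open>k + 1\<close> or
      \<open>k + 2\<close>, each of which needs a tall stack among the three short stacks
      \<open>k - 1\<close>, \<open>k\<close>, \<open>k + 1\<close>.\<close>
    case B: 2
    then have "run_start n (k + 1)" by (simp add: run_start_def frozen_def)
    from persist[OF this] obtain j where j: "\<bar>j - (k + 1)\<bar> \<le> 1" "run_start ?n' j" by blast
    then have "j = k \<or> j = k + 1 \<or> j = k + 2" by linarith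
    with j(2) s show ?thesis by (auto simp: run_start_def frozen_def algebra_simps)
  qed
qed

section \<open>Height functions and the inward drift of a run end\<close>

definition is_height :: "(int \<Rightarrow> nat) \<Rightarrow> (int \<Rightarrow> int) \<Rightarrow> bool" where
  "is_height n h \<longleftrightarrow> (\<forall>k. h k = h (k - 1) + int (n k) - 1)"

text \<open>The value \<open>h k\<close> belongs to the bond between \<open>k\<close> and
  \<open>k + 1\<close>; only the current across that bond changes it.\<close>

lemma height_step:
  assumes "is_height n h"
  shows "is_height (ssm_step \<omega> n) (\<lambda>k. h k - ssm_current \<omega> n k)"
  unfolding is_height_def
proof
  fix k
  show "h k - ssm_current \<omega> n k =
      h (k - 1) - ssm_current \<omega> n (k - 1) + int (ssm_step \<omega> n k) - 1"
    using assms[unfolded is_height_def, rule_format, of k] unfolding ssm_step_int by linarith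
qed

lemma height_succ:
  assumes "is_height n h"
  shows "h (k + 1) = h k + int (n (k + 1)) - 1"
  using assms[unfolded is_height_def, rule_format, of "k + 1"] by simp

text \<open>The bound \<open>\<phi>\<close> is a potential of the run starting at \<open>a\<close>, built from the last bond \<open>x\<close> before \<open>a\<close>
  below level \<open>l\<close>. It grows by 1 in every step in which particles are pushed right, and it stays below
  \<open>a\<close>.\<close>

definition pushed :: "(int \<Rightarrow> nat) \<Rightarrow> (int \<Rightarrow> int) \<Rightarrow> int \<Rightarrow> int \<Rightarrow> int \<Rightarrow> bool" where
  "pushed n h a l \<phi> \<longleftrightarrow> is_height n h \<and> run_start n a \<and> h a = l \<and>
     (\<forall>k<a. frozen n k \<longrightarrow> h k < l) \<and>
     (\<exists>x<a. h x < l \<and> (\<forall>y. x < y \<and> y < a \<longrightarrow> l \<le> h y) \<and>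
        \<phi> \<le> x - 2 * (\<Sum>y\<in>{x<..<a}. h y - l))"

lemma pushed_less:
  assumes "pushed n h a l \<phi>"
  shows "\<phi> < a"
proof -
  obtain x where x: "x < a" "\<forall>y. x < y \<and> y < a \<longrightarrow> l \<le> h y"
      "\<phi> \<le> x - 2 * (\<Sum>y\<in>{x<..<a}. h y - l)"
    using assms unfolding pushed_def by blast
  have "0 \<le> (\<Sum>y\<in>{x<..<a}. h y - l)" using x(2) by (intro sum_nonneg) auto
  with x show ?thesis by linarith
qed

lemma sum_telescope_int:
  fixes u :: "int \<Rightarrow> int"
  assumes "x < a"
  shows "(\<Sum>y\<in>{x<..<a}. u (y + 1) - u y) = u a - u (x + 1)"
proof -
  have "x + 1 \<le> a" using assms by simp
  then show ?thesis
  proof (induction a rule: int_ge_induct)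
    case base
    have "{x<..<x + 1} = {}" by auto
    then show ?case by simp
  next
    case (step a)
    then have "{x<..<a + 1} = insert a {x<..<a}" by auto
    with step show ?case by simp
  qed
qed

lemma ex_greatest_int:
  fixes c :: int
  assumes "P z" "z < c"
  shows "\<exists>x. z \<le> x \<and> x < c \<and> P x \<and> (\<forall>y. x < y \<and> y < c \<longrightarrow> \<not> P y)"
proof -
  define L where "L = {y\<in>{z..<c}. P y}"
  have "finite L" unfolding L_def by (rule finite_subset[of _ "{z..<c}"]) auto
  moreover have "z \<in> L" unfolding L_def using assms by simp
  ultimately obtain x where x: "x \<in> L" "\<forall>y\<in>L. y \<le> x" using Max_in Max_ge by blast
  have "\<not> P y" if "x < y" "y < c" for y
  proof
    assume "P y"
    with that x(1) have "y \<in> L" by (simp add: L_def)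
    with x(2) that(1) show False by fastforce
  qed
  moreover have "z \<le> x \<and> x < c \<and> P x" using x(1) by (simp add: L_def)
  ultimately show ?thesis by blast
qed

text \<open>Every tall stack before \<open>a\<close> sends a particle right, and the level
  \<open>l\<close> is inherited by the new start. The excess area over \<open>l\<close> drops by 1
  while the last low bond \<open>x\<close> retreats by at most 1; counting the area twice leaves a
  gain of 1. If \<open>h (x + 1) = l\<close>, the area bound need not drop, but \<open>x\<close>
  advances instead.\<close>

lemma pushed_step:
  assumes push: "pushed n h a l \<phi>"
    and coins: "\<And>k. k < a \<Longrightarrow> \<omega> k"
    and a': "run_start (ssm_step \<omega> n) a'" "\<bar>a' - a\<bar> \<le> 1"
    and zeros: "\<And>k. inner_zero n k \<Longrightarrow> inner_zero (ssm_step \<omega> n) k"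
  shows "pushed (ssm_step \<omega> n) (\<lambda>k. h k - ssm_current \<omega> n k) a' l (\<phi> + 1)"
proof -
  define n' where "n' = ssm_step \<omega> n"
  define c where "c = ssm_current \<omega> n"
  define h' where "h' k = h k - c k" for k
  have hn: "is_height n h" and rs: "run_start n a" and ha: "h a = l"
    and below: "\<And>k. k < a \<Longrightarrow> frozen n k \<Longrightarrow> h k < l"
    using push unfolding pushed_def by auto
  obtain x where x: "x < a" "h x < l" "\<And>y. x < y \<Longrightarrow> y < a \<Longrightarrow> l \<le> h y"
      and \<phi>: "\<phi> \<le> x - 2 * (\<Sum>y\<in>{x<..<a}. h y - l)"
    using push unfolding pushed_def by blast
  have rs': "run_start n' a'" using a' by (simp add: n'_def)
  have hn': "is_height n' h'" unfolding n'_def h'_def c_def by (rule height_step[OF hn])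
  have up: "h (k + 1) = h k + int (n (k + 1)) - 1" for k by (rule height_succ[OF hn])
  have up': "h' (k + 1) = h' k + int (n' (k + 1)) - 1" for k by (rule height_succ[OF hn'])
  have frz: "frozen n k \<Longrightarrow> h' k = h k" for k by (simp add: h'_def c_def current_frozen)
  have fa: "frozen n a" using rs by (auto simp: run_start_def frozen_def)
  then have h'a: "h' a = l" using ha frz by simp
  have n'a: "n' a = n a + 1"
  proof -
    have "c (a - 1) = 1" unfolding c_def using rs by (intro current_tall_short) (auto simp: run_start_def)
    moreover have "c a = 0" unfolding c_def using fa by (rule current_frozen)
    ultimately show ?thesis using step_at(1)[of \<omega> n a] unfolding n'_def c_def by linarith
  qed
  have a'_cases: "a' = a - 1 \<or> a' = a \<or> a' = a + 1" using a' by linarith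
  \<comment> \<open>The start moves only across a stack that now holds exactly one particle, where
    the height is flat. Moving left, the short stack \<open>a\<close> has just received one. Moving
    right, an empty stack \<open>a + 1\<close> would come from an inner zero, which persists and
    keeps stack \<open>a\<close> short.\<close>
  have h'a': "h' a' = l"
    using a'_cases
  proof (elim disjE)
    assume e: "a' = a - 1"
    with rs' have "n' a \<le> 1" by (simp add: run_start_def)
    with n'a have "n' a = 1" by simp
    with up'[of "a - 1"] h'a e show ?thesis by simp
  next
    assume "a' = a" with h'a show ?thesis by simp
  next
    assume e: "a' = a + 1"
    with rs' have t: "\<not> short (n' a)" "short (n' (a + 1))" by (auto simp: run_start_def)
    have "n' (a + 1) = 1"
    proof (rule ccontr)
      assume "n' (a + 1) \<noteq> 1"
      with t have z: "n' (a + 1) = 0" by simp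
      have ca: "ssm_current \<omega> n a = 0" using fa by (rule current_frozen)
      from fa have sh: "short (n (a + 1))" by (simp add: frozen_def)
      have sh2: "short (n (a + 1 + 1))"
      proof (rule ccontr)
        assume "\<not> ?thesis"
        with sh have "ssm_current \<omega> n (a + 1) = - 1" by (intro current_short_tall)
        with ca step_at(3)[of \<omega> n a] z show False by (simp add: n'_def)
      qed
      with sh have "ssm_current \<omega> n (a + 1) = 0" by (intro current_frozen) (simp add: frozen_def)
      with ca step_at(3)[of \<omega> n a] z have "n (a + 1) = 0" by (simp add: n'_def)
      with sh2 fa have "inner_zero n (a + 1)" by (simp add: inner_zero_def frozen_def)
      from zeros[OF this] t show False by (simp add: inner_zero_def n'_def)
    qed
    with up'[of a] h'a e show ?thesis by simp
  qed
  \<comment> \<open>A newly frozen bond lies next to an old frozen one before \<open>a\<close>,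
    across a stack that now holds one particle, so both have the same height.\<close>
  have below': "h' k < l" if k: "k < a'" "frozen n' k" for k
  proof -
    have ka: "k < a"
    proof (rule ccontr)
      assume "\<not> k < a"
      with k a'_cases have "k = a" "a' = a + 1" by auto
      with rs' k show False by (simp add: run_start_def frozen_def)
    qed
    from k(2)[unfolded n'_def] show ?thesis
    proof (cases rule: frozen_step_cases)
      case 1
      with below[OF ka] frz show ?thesis by simp
    next
      case 2
      have "k + 1 \<noteq> a"
      proof
        assume e: "k + 1 = a"
        then have "k = a - 1" by simp
        with a'_cases k rs' e show False by (auto simp: run_start_def frozen_def)
      qed
      with ka have "h (k + 1) < l" using below 2 by simp
      moreover have "h' (k + 1) = h' k" using up'[of k] 2 by (simp add: n'_def)
      ultimately show ?thesis using frz 2 by simp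
    next
      case 3
      have "h (k - 1) < l" using below 3 ka by simp
      moreover have "h' (k - 1) = h' k" using up'[of "k - 1"] 3 by (simp add: n'_def)
      ultimately show ?thesis using frz[of "k - 1"] 3 by simp
    qed
  qed
  have xa: "x + 1 < a"
  proof (rule ccontr)
    assume "\<not> ?thesis"
    with x(1) have "x + 1 = a" by simp
    with up[of x] ha x(2) rs show False by (simp add: run_start_def)
  qed
  have x1: "\<not> short (n (x + 1))" "l \<le> h (x + 1)"
    using x(3)[of "x + 1"] xa x(2) up[of x] by auto
  \<comment> \<open>Correction for clipping the excess at 0: pushing right takes bond
    \<open>x + 1\<close> to \<open>l - 1\<close> exactly when it was at \<open>l\<close>.\<close>
  define e :: int where "e = of_bool (h (x + 1) = l)"
  have tallc: "c k = 1" if "k < a" "\<not> short (n k)" for k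
    using that coins[of k] by (simp add: c_def ssm_current_def)
  have drop: "(\<Sum>y\<in>{x<..<a}. max 0 (h' y - l)) \<le> (\<Sum>y\<in>{x<..<a}. h y - l) - 1 + e"
  proof -
    \<comment> \<open>A bond falls if its left stack is tall and rises only from short to tall, so
      its change is at most the increment of the indicator \<open>u\<close>. The sum telescopes from
      the tall stack \<open>x + 1\<close> to the short stack \<open>a\<close>, giving -1.\<close>
    define u :: "int \<Rightarrow> int" where "u y = of_bool (\<not> short (n y))" for y
    have "(\<Sum>y\<in>{x<..<a}. max 0 (h' y - l)) \<le>
        (\<Sum>y\<in>{x<..<a}. (h y - l) + (u (y + 1) - u y) + (if y = x + 1 then e else 0))"
    proof (rule sum_mono)
      fix y assume "y \<in> {x<..<a}"
      then have y: "x < y" "y < a" by auto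
      have h0: "l \<le> h y" using x(3) y by simp
      have bound: "h' y \<le> h y + (u (y + 1) - u y)"
        using tallc[OF y(2)] by (cases rule: current_cases[of n y \<omega>]) (auto simp: h'_def c_def u_def)
      have "h y - 1 \<le> h' y" using current_range[of \<omega> n y] by (auto simp: h'_def c_def)
      \<comment> \<open>Only a bond right after a tall stack falls, so a bond falling below
        \<open>l\<close> has a low bond just before it, and that must be \<open>x\<close>.\<close>
      moreover have "y = x + 1" if "h' y < l"
      proof -
        from that h0 have "h y = l" "c y > 0" using \<open>h y - 1 \<le> h' y\<close> by (auto simp: h'_def)
        then have "\<not> short (n y)" using current_cases[of n y \<omega>] by (auto simp: c_def)
        then have "h (y - 1) < l" using up[of "y - 1"] \<open>h y = l\<close> by simp
        with x(3)[of "y - 1"] y show ?thesis by fastforce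
      qed
      moreover have "(if y = x + 1 then e else 0) = 1" if "y = x + 1" "h y = l"
        using that by (simp add: e_def)
      moreover have "0 \<le> (if y = x + 1 then e else 0)" by (simp add: e_def)
      ultimately show "max 0 (h' y - l) \<le> (h y - l) + (u (y + 1) - u y) + (if y = x + 1 then e else 0)"
        using bound h0 by (cases "h' y < l") (auto simp: max_def)
    qed
    also have "\<dots> = (\<Sum>y\<in>{x<..<a}. h y - l) + (u a - u (x + 1)) + e"
      using xa by (simp add: sum.distrib sum_telescope_int x(1))
    also have "u a = 0" using rs by (simp add: u_def run_start_def)
    also have "u (x + 1) = 1" using x1 by (simp add: u_def)
    finally show ?thesis by simp
  qed
  \<comment> \<open>The bond \<open>z\<close> is \<open>x + 1\<close> when that was at level
    \<open>l\<close>, otherwise \<open>x\<close>, or \<open>x - 1\<close> when \<open>x\<close>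
    itself rises to \<open>l\<close>. In the last case stack \<open>x\<close> is short, and bond
    \<open>x - 1\<close> is either frozen below \<open>l\<close> or lowered by its tall left
    stack.\<close>
  have "\<exists>z. x - 1 + 2 * e \<le> z \<and> z < a' \<and> h' z < l \<and>
      (\<Sum>y\<in>{z<..<a}. max 0 (h' y - l)) \<le> (\<Sum>y\<in>{x<..<a}. max 0 (h' y - l))"
  proof -
    have sub: "(\<Sum>y\<in>{z<..<a}. max 0 (h' y - l)) \<le> (\<Sum>y\<in>{x<..<a}. max 0 (h' y - l))" if "x \<le> z" for z
      using that by (intro sum_mono2) auto
    consider "h (x + 1) = l" | "h (x + 1) \<noteq> l" "h' x < l" | "h (x + 1) \<noteq> l" "l \<le> h' x" by linarith
    then show ?thesis
    proof cases
      case 1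
      have low: "h' (x + 1) < l" using 1 tallc[of "x + 1"] xa x1 by (simp add: h'_def)
      have "x + 1 < a'"
      proof (rule ccontr)
        assume "\<not> ?thesis"
        with xa a'_cases have "a' = x + 1" by auto
        with low h'a' show False by simp
      qed
      with low sub[of "x + 1"] 1 show ?thesis by (intro exI[of _ "x + 1"]) (simp add: e_def)
    next
      case 2
      moreover have "x < a'" using a'_cases xa by linarith
      ultimately show ?thesis by (intro exI[of _ x]) (simp add: e_def)
    next
      case 3
      then have cx: "c x = - 1" "h x = l - 1" "h' x = l"
        using x(2) current_range[of \<omega> n x] by (auto simp: h'_def c_def)
      then have sx: "short (n x)" using tallc[of x] x(1) by fastforce
      have "h (x - 1) \<le> l" using up[of "x - 1"] cx by simp
      then have low: "h' (x - 1) < l"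
      proof (cases "short (n (x - 1))")
        case True
        then have "frozen n (x - 1)" using sx by (simp add: frozen_def)
        with below[of "x - 1"] x(1) frz show ?thesis by simp
      next
        case False
        with tallc[of "x - 1"] x(1) \<open>h (x - 1) \<le> l\<close> show ?thesis by (simp add: h'_def)
      qed
      have "{x - 1<..<a} = insert x {x<..<a}" using x(1) by auto
      then have "(\<Sum>y\<in>{x - 1<..<a}. max 0 (h' y - l)) = (\<Sum>y\<in>{x<..<a}. max 0 (h' y - l))"
        using cx by simp
      moreover have "x - 1 < a'" using a'_cases xa by linarith
      ultimately show ?thesis using low 3 by (intro exI[of _ "x - 1"]) (simp add: e_def)
    qed
  qed
  then obtain z where z: "x - 1 + 2 * e \<le> z" "z < a'" "h' z < l"
    and zsum: "(\<Sum>y\<in>{z<..<a}. max 0 (h' y - l)) \<le> (\<Sum>y\<in>{x<..<a}. max 0 (h' y - l))" by blast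
  obtain x' where x'z: "z \<le> x'" and x': "x' < a'" "h' x' < l"
    and not_low: "\<forall>y. x' < y \<and> y < a' \<longrightarrow> \<not> h' y < l"
    using ex_greatest_int[of "\<lambda>y. h' y < l" z a', OF z(3,2)] by blast
  have high: "l \<le> h' y" if "x' < y" "y < a'" for y using not_low that by force
  have "(\<Sum>y\<in>{x'<..<a'}. h' y - l) = (\<Sum>y\<in>{x'<..<a'}. max 0 (h' y - l))"
    using high by (intro sum.cong) auto
  \<comment> \<open>The new start is at most \<open>a + 1\<close>, and the extra bond
    \<open>a\<close> contributes nothing because \<open>h' a = l\<close>.\<close>
  also have "\<dots> \<le> (\<Sum>y\<in>{z<..<a + 1}. max 0 (h' y - l))"
    using x'z a'_cases by (intro sum_mono2) auto
  also have "\<dots> = (\<Sum>y\<in>{z<..<a}. max 0 (h' y - l))"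
  proof (rule sum.mono_neutral_right)
    show "\<forall>y\<in>{z<..<a + 1} - {z<..<a}. max 0 (h' y - l) = 0"
    proof
      fix y assume "y \<in> {z<..<a + 1} - {z<..<a}"
      then have "y = a" by auto
      then show "max 0 (h' y - l) = 0" using h'a by simp
    qed
  qed auto
  finally have "(\<Sum>y\<in>{x'<..<a'}. h' y - l) \<le> (\<Sum>y\<in>{x<..<a}. h y - l) - 1 + e"
    using zsum drop by linarith
  then have "\<phi> + 1 \<le> x' - 2 * (\<Sum>y\<in>{x'<..<a'}. h' y - l)"
    using \<phi> z(1) x'z by linarith
  with high x' have "\<exists>x<a'. h' x < l \<and> (\<forall>y. x < y \<and> y < a' \<longrightarrow> l \<le> h' y) \<and>
      \<phi> + 1 \<le> x - 2 * (\<Sum>y\<in>{x<..<a'}. h' y - l)"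
    by (intro exI[of _ x'] conjI allI impI) auto
  then have "pushed n' h' a' l (\<phi> + 1)"
    unfolding pushed_def using hn' rs' h'a' below' by simp
  moreover have "h' = (\<lambda>k. h k - ssm_current \<omega> n k)" by (simp add: h'_def c_def fun_eq_iff)
  ultimately show ?thesis by (simp add: n'_def)
qed

section \<open>Mirror images, and the collision of two run ends\<close>

lemma height_reflect:
  assumes "is_height n h"
  shows "is_height (reflect n) (\<lambda>k. - h (- k - 1))"
  unfolding is_height_def reflect_def
proof
  fix k
  show "- h (- k - 1) = - h (- (k - 1) - 1) + int (n (- k)) - 1"
    using assms[unfolded is_height_def, rule_format, of "- k"] by simp
qed

text \<open>Bond \<open>k\<close> of the mirror image is bond \<open>- k - 1\<close> of
  \<open>n\<close>; left and right are exchanged, so the current changes sign and the coin is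
  negated.\<close>

lemma current_reflect:
  "ssm_current (\<lambda>k. \<not> \<omega> (- k - 1)) (reflect n) k = - ssm_current \<omega> n (- k - 1)"
proof -
  have "- (k + 1) = - k - 1" "- k - 1 + 1 = - k" by simp_all
  then show ?thesis unfolding ssm_current_def reflect_def by simp
qed

lemma ssm_step_reflect:
  "reflect (ssm_step \<omega> n) = ssm_step (\<lambda>k. \<not> \<omega> (- k - 1)) (reflect n)"
  unfolding ssm_step_def current_reflect by (auto simp: fun_eq_iff reflect_def algebra_simps)

lemma frozen_reflect: "frozen (reflect n) k \<longleftrightarrow> frozen n (- k - 1)"
proof -
  have "- (k + 1) = - k - 1" "- k - 1 + 1 = - k" by simp_all
  then show ?thesis unfolding frozen_def reflect_def by auto
qed

text \<open>A start \<open>- b\<close> of the mirror image is a right end \<open>b\<close>. Ends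
  that were in order and moved by at most one site each satisfy \<open>a - 1 \<le> b\<close>; the
  tall stacks just outside the ends exclude \<open>b = a\<close> and
  \<open>b = a - 1\<close>.\<close>

lemma run_start_less_run_end:
  assumes "run_start n a" "run_start (reflect n) (- b)" "a - 1 \<le> b"
  shows "a < b"
proof (rule ccontr)
  assume "\<not> ?thesis"
  with assms(3) have "b = a \<or> b = a - 1" by linarith
  with assms(1,2) show False by (auto simp: run_start_def reflect_def)
qed

text \<open>Far to the left the height is below \<open>h b\<close>, so only finitely many frozen
  bonds up to \<open>b\<close> reach \<open>h b\<close>; \<open>a\<close> is the leftmost of them.
  If stack \<open>a - 1\<close> were short, bond \<open>a - 1\<close> would be frozen and at least
  as high as \<open>a\<close>.\<close>

lemma pushed_init:
  assumes h: "is_height n h" and lim: "\<And>C. \<exists>K. \<forall>k\<le>K. h k < C" and fr: "frozen n b"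
  shows "\<exists>a l \<phi>. a \<le> b \<and> pushed n h a l \<phi>"
proof -
  obtain K where K: "\<forall>k\<le>K. h k < h b" using lim by blast
  define F where "F = {k\<in>{K..b}. frozen n k \<and> h b \<le> h k}"
  have "K < b" using K by (meson le_less_linear less_irrefl)
  then have F: "finite F" "b \<in> F"
    unfolding F_def using fr by (auto intro: finite_subset[of _ "{K..b}"])
  define a where "a = Min F"
  have aF: "a \<in> F" unfolding a_def using F by (intro Min_in) auto
  have less: "h k < h b" if "frozen n k" "k < a" for k
  proof (rule ccontr)
    assume "\<not> ?thesis"
    then have "K \<le> k" using K by (meson linear)
    with \<open>\<not> h k < h b\<close> that aF have "k \<in> F" unfolding F_def by auto
    with F(1) have "a \<le> k" by (simp add: a_def)
    with that show False by simp
  qed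
  have ha: "h b \<le> h a" and fa: "frozen n a" and ab: "a \<le> b" using aF by (auto simp: F_def)
  have rs: "run_start n a"
  proof -
    have "\<not> short (n (a - 1))"
    proof
      assume "short (n (a - 1))"
      with fa have "frozen n (a - 1)" by (simp add: frozen_def)
      with less[of "a - 1"] ha h[unfolded is_height_def, rule_format, of a] fa show False
        by (simp add: frozen_def)
    qed
    with fa show ?thesis by (simp add: run_start_def frozen_def)
  qed
  obtain K' where K': "\<forall>k\<le>K'. h k < h a" using lim by blast
  then have "h (min K' (a - 1)) < h a" "min K' (a - 1) < a" by simp_all
  then obtain x where x: "x < a" "h x < h a" "\<forall>y. x < y \<and> y < a \<longrightarrow> \<not> h y < h a"
    using ex_greatest_int[of "\<lambda>k. h k < h a" "min K' (a - 1)" a] by blast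
  have "\<forall>k<a. frozen n k \<longrightarrow> h k < h a" using less ha by force
  moreover have "\<forall>y. x < y \<and> y < a \<longrightarrow> h a \<le> h y" using x(3) by (auto simp: not_less)
  ultimately have "pushed n h a (h a) (x - 2 * (\<Sum>y\<in>{x<..<a}. h y - h a))"
    unfolding pushed_def using h rs x(1,2) by blast
  with ab show ?thesis by blast
qed

text \<open>The coins push particles right before a tracked left end \<open>a\<close> of a run and left after it, hence
  also after a tracked right end further right. Both ends drift inwards at unit speed, although they
  can never meet.\<close>

lemma no_frozen_bond:
  assumes S: "\<And>n \<omega>. n \<in> S \<Longrightarrow> ssm_step \<omega> n \<in> S"
    and starts: "\<And>n \<omega> i. n \<in> S \<Longrightarrow> run_start n i \<Longrightarrow> \<exists>j. \<bar>j - i\<bar> \<le> 1 \<and> run_start (ssm_step \<omega> n) j"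
    and ends: "\<And>n \<omega> i. n \<in> S \<Longrightarrow> run_start (reflect n) i \<Longrightarrow>
        \<exists>j. \<bar>j - i\<bar> \<le> 1 \<and> run_start (reflect (ssm_step \<omega> n)) j"
    and zeros: "\<And>n \<omega> i. n \<in> S \<Longrightarrow> inner_zero n i \<Longrightarrow> inner_zero (ssm_step \<omega> n) i"
    and n: "n \<in> S" and h: "is_height n h"
    and bot: "\<And>C. \<exists>K. \<forall>k\<le>K. h k < C" and top: "\<And>C. \<exists>K. \<forall>k\<ge>K. C < h k"
  shows "\<not> frozen n k"
proof
  assume fr: "frozen n k"
  obtain a l \<phi> where a: "a \<le> k" "pushed n h a l \<phi>" using pushed_init[OF h bot fr] by blast
  have "\<exists>K. \<forall>k\<le>K. - h (- k - 1) < C" for C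
  proof -
    obtain K where "\<forall>k\<ge>K. - C < h k" using top by blast
    then have "\<forall>k\<le>- K - 1. - h (- k - 1) < C" by (auto simp: minus_less_iff)
    then show ?thesis by blast
  qed
  then obtain b m \<psi> where b: "b \<le> - k - 1" "pushed (reflect n) (\<lambda>k. - h (- k - 1)) b m \<psi>"
    using pushed_init[OF height_reflect[OF h], of "- k - 1"] fr by (auto simp: frozen_reflect)
  have "\<exists>n\<in>S. \<exists>h a b. a < - b \<and> pushed n h a l (\<phi> + int t) \<and>
      pushed (reflect n) (\<lambda>k. - h (- k - 1)) b m (\<psi> + int t)" for t
  proof (induction t)
    case 0
    show ?case using n a b by (intro bexI[of _ n] exI[of _ h] exI[of _ a] exI[of _ b]) auto
  next
    case (Suc t)
    then obtain n h a b where n: "n \<in> S" "a < - b" and pa: "pushed n h a l (\<phi> + int t)"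
      and pb: "pushed (reflect n) (\<lambda>k. - h (- k - 1)) b m (\<psi> + int t)" by blast
    define \<omega> where "\<omega> k \<longleftrightarrow> k < a" for k :: int
    define \<omega>' where "\<omega>' k \<longleftrightarrow> \<not> \<omega> (- k - 1)" for k
    have refl: "reflect (ssm_step \<omega> n) = ssm_step \<omega>' (reflect n)"
      unfolding \<omega>'_def by (rule ssm_step_reflect)
    obtain a' where a': "\<bar>a' - a\<bar> \<le> 1" "run_start (ssm_step \<omega> n) a'"
      using starts[OF n(1), of a \<omega>] pa by (auto simp: pushed_def)
    obtain b' where b': "\<bar>b' - b\<bar> \<le> 1" "run_start (ssm_step \<omega>' (reflect n)) b'"
      using ends[OF n(1), of b \<omega>] pb by (auto simp: pushed_def refl)
    have pa': "pushed (ssm_step \<omega> n) (\<lambda>k. h k - ssm_current \<omega> n k) a' l (\<phi> + int t + 1)"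
      by (rule pushed_step[OF pa _ a'(2,1) zeros[OF n(1)]]) (simp add: \<omega>_def)
    have zero: "inner_zero (reflect n) k \<longleftrightarrow> inner_zero n (- k)" for n k
    proof -
      have "- (k + 1) = - k - 1" "- (k - 1) = - k + 1" by simp_all
      then show ?thesis unfolding inner_zero_def reflect_def by auto
    qed
    have "pushed (ssm_step \<omega>' (reflect n))
        (\<lambda>k. - h (- k - 1) - ssm_current \<omega>' (reflect n) k) b' m (\<psi> + int t + 1)"
    proof (rule pushed_step[OF pb _ b'(2,1)])
      show "\<omega>' k" if "k < b" for k using that n(2) by (simp add: \<omega>'_def \<omega>_def)
      show "inner_zero (ssm_step \<omega>' (reflect n)) k" if "inner_zero (reflect n) k" for k
        using zeros[OF n(1)] that unfolding refl[symmetric] zero by blast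
    qed
    then have pb': "pushed (reflect (ssm_step \<omega> n))
        (\<lambda>k. - (h (- k - 1) - ssm_current \<omega> n (- k - 1))) b' m (\<psi> + int t + 1)"
      unfolding refl \<omega>'_def current_reflect by simp
    have "a' < - b'"
      using a' b' n(2) by (intro run_start_less_run_end[of "ssm_step \<omega> n"]) (auto simp: refl)
    moreover have t: "\<phi> + int (Suc t) = \<phi> + int t + 1" "\<psi> + int (Suc t) = \<psi> + int t + 1"
      by simp_all
    ultimately show ?case
      unfolding t using pa' pb' S[OF n(1), of \<omega>]
      by (intro bexI[of _ "ssm_step \<omega> n"] exI[where x = "\<lambda>k. h k - ssm_current \<omega> n k"])
         (rule exI[of _ a'], rule exI[of _ b'], simp_all)
  qed
  \<comment> \<open>Adding the two bounds at time \<open>t\<close> gives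
    \<open>\<phi> + \<psi> + 2 * int t < a + b < 0\<close>, which fails for this
    \<open>t\<close>.\<close>
  from this[of "nat (\<bar>\<phi>\<bar> + \<bar>\<psi>\<bar>)"] obtain n h a b where "a < - b"
    "pushed n h a l (\<phi> + int (nat (\<bar>\<phi>\<bar> + \<bar>\<psi>\<bar>)))"
    "pushed (reflect n) (\<lambda>k. - h (- k - 1)) b m (\<psi> + int (nat (\<bar>\<phi>\<bar> + \<bar>\<psi>\<bar>)))" by blast
  with pushed_less[OF this(2)] pushed_less[OF this(3)] show False by linarith
qed

section \<open>Holes of the exclusion process as stacks\<close>

text \<open>The index set is all of the integers, so an enumeration exists only if there are
  infinitely many holes on both sides.\<close>

definition hole_enum :: "(int \<Rightarrow> bool) \<Rightarrow> (int \<Rightarrow> int) \<Rightarrow> bool" where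
  "hole_enum \<eta> p \<longleftrightarrow> strict_mono p \<and> (\<forall>i. \<not> \<eta> i \<longleftrightarrow> i \<in> range p)"

definition stacks :: "(int \<Rightarrow> int) \<Rightarrow> int \<Rightarrow> nat" where
  "stacks p k = nat (p (k + 1) - p k - 1)"

lemma strict_mono_intI:
  fixes p :: "int \<Rightarrow> int"
  assumes "\<And>k. p k < p (k + 1)"
  shows "strict_mono p"
proof (rule strict_monoI)
  fix j k :: int assume "j < k"
  then show "p j < p k"
  proof (induction k rule: int_gr_induct)
    case base show ?case by (rule assms)
  next
    case (step k) then show ?case using assms[of k] by simp
  qed
qed

lemma stacks_int:
  assumes "strict_mono p"
  shows "int (stacks p k) = p (k + 1) - p k - 1"
  using strict_monoD[OF assms, of k "k + 1"] by (simp add: stacks_def)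

lemma hole_enum_hole: "hole_enum \<eta> p \<Longrightarrow> \<not> \<eta> (p k)"
  by (auto simp: hole_enum_def)

lemma hole_enum_between:
  assumes "hole_enum \<eta> p" "p k < i" "i < p (k + 1)"
  shows "\<eta> i"
proof (rule ccontr)
  assume "\<not> \<eta> i"
  with assms(1) obtain j where "i = p j" by (auto simp: hole_enum_def)
  with assms show False by (auto simp: hole_enum_def strict_mono_less)
qed

lemma hole_enum_next:
  assumes "hole_enum \<eta> p"
  shows "p (k + 1) = p k + 1 + int (stacks p k)"
  using stacks_int[of p k] assms by (simp add: hole_enum_def)

lemma tall_after_hole:
  assumes "hole_enum \<eta> p"
  shows "\<eta> (p k + 1) \<and> \<eta> (p k + 2) \<longleftrightarrow> \<not> short (stacks p k)"
proof
  assume "\<not> short (stacks p k)"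
  with hole_enum_next[OF assms, of k] have "p k + 2 < p (k + 1)" by linarith
  then show "\<eta> (p k + 1) \<and> \<eta> (p k + 2)" by (auto intro!: hole_enum_between[OF assms, of k])
next
  assume t: "\<eta> (p k + 1) \<and> \<eta> (p k + 2)"
  show "\<not> short (stacks p k)"
  proof
    assume "short (stacks p k)"
    with hole_enum_next[OF assms, of k] have "p (k + 1) = p k + 1 \<or> p (k + 1) = p k + 2" by linarith
    with t hole_enum_hole[OF assms, of "k + 1"] show False by auto
  qed
qed

lemma tall_before_hole:
  assumes "hole_enum \<eta> p"
  shows "\<eta> (p (k + 1) - 1) \<and> \<eta> (p (k + 1) - 2) \<longleftrightarrow> \<not> short (stacks p k)"
proof
  assume "\<not> short (stacks p k)"
  with hole_enum_next[OF assms, of k] have "p k < p (k + 1) - 2" by linarith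
  then show "\<eta> (p (k + 1) - 1) \<and> \<eta> (p (k + 1) - 2)" by (auto intro!: hole_enum_between[OF assms, of k])
next
  assume t: "\<eta> (p (k + 1) - 1) \<and> \<eta> (p (k + 1) - 2)"
  show "\<not> short (stacks p k)"
  proof
    assume "short (stacks p k)"
    with hole_enum_next[OF assms, of k] have "p k = p (k + 1) - 1 \<or> p k = p (k + 1) - 2" by linarith
    with t hole_enum_hole[OF assms, of k] show False by auto
  qed
qed

text \<open>A particle crossing bond \<open>k\<close> of the stack model to the right moves hole \<open>k + 1\<close> to the left.\<close>

definition moved_holes :: "(int \<Rightarrow> bool) \<Rightarrow> (int \<Rightarrow> int) \<Rightarrow> int \<Rightarrow> int" where
  "moved_holes \<omega> p k = p k - ssm_current (\<lambda>k. \<omega> (p (k + 1))) (stacks p) (k - 1)"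

lemma stacks_moved:
  assumes "hole_enum \<eta> p"
  shows "moved_holes \<omega> p (k + 1) =
    moved_holes \<omega> p k + 1 + int (ssm_step (\<lambda>k. \<omega> (p (k + 1))) (stacks p) k)"
  unfolding ssm_step_int using hole_enum_next[OF assms, of k] by (simp add: moved_holes_def)

text \<open>The particle before hole \<open>k + 1\<close> attempts to jump exactly when stack
  \<open>k\<close> is tall and then has a competitor exactly when stack \<open>k + 1\<close> is
  tall; the coin at the hole serves as the coin of bond \<open>k\<close>.\<close>

lemma jumps_right_iff:
  assumes "hole_enum \<eta> p"
  shows "jumps_right \<omega> \<eta> (p (k + 1) - 1) \<longleftrightarrow> ssm_current (\<lambda>k. \<omega> (p (k + 1))) (stacks p) k = 1"
  using tall_before_hole[OF assms, of k] tall_after_hole[OF assms, of "k + 1"]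
    hole_enum_hole[OF assms, of "k + 1"]
  unfolding jumps_right_def attempts_right_def attempts_left_def ssm_current_def
  by (auto simp: algebra_simps)

lemma jumps_left_iff:
  assumes "hole_enum \<eta> p"
  shows "jumps_left \<omega> \<eta> (p (k + 1) + 1) \<longleftrightarrow> ssm_current (\<lambda>k. \<omega> (p (k + 1))) (stacks p) k = - 1"
  using tall_before_hole[OF assms, of k] tall_after_hole[OF assms, of "k + 1"]
    hole_enum_hole[OF assms, of "k + 1"]
  unfolding jumps_left_def attempts_right_def attempts_left_def ssm_current_def
  by (auto simp: algebra_simps)

text \<open>A jump exchanges a particle with a hole, so each hole moves against the current of its
  bond. Conversely, a site empty after the step is a hole nobody entered or a site just vacated next
  to the hole entered.\<close>

lemma hole_enum_step:
  assumes p: "hole_enum \<eta> p"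
  shows "hole_enum (fssep_step \<omega> \<eta>) (moved_holes \<omega> p)"
    and "stacks (moved_holes \<omega> p) = ssm_step (\<lambda>k. \<omega> (p (k + 1))) (stacks p)"
proof -
  let ?c = "ssm_current (\<lambda>k. \<omega> (p (k + 1))) (stacks p)"
  let ?p' = "moved_holes \<omega> p"
  have mono: "strict_mono ?p'"
    by (rule strict_mono_intI) (simp add: stacks_moved[OF p])
  have p'1: "?p' (k + 1) = p (k + 1) - ?c k" for k by (simp add: moved_holes_def)
  have hole: "\<not> fssep_step \<omega> \<eta> (?p' (k + 1))" for k
  proof -
    have q: "\<not> \<eta> (p (k + 1))" by (rule hole_enum_hole[OF p])
    consider "?c k = 1" | "?c k = 0" | "?c k = - 1" using current_range by blast
    then show ?thesis
    proof cases
      case 1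
      then have "jumps_right \<omega> \<eta> (p (k + 1) - 1)" using jumps_right_iff[OF p] by simp
      with 1 q show ?thesis
        by (auto simp: p'1 fssep_step_def jumps_right_def jumps_left_def attempts_right_def attempts_left_def)
    next
      case 2
      with q jumps_right_iff[OF p, of \<omega> k] jumps_left_iff[OF p, of \<omega> k] show ?thesis
        by (auto simp: p'1 fssep_step_def)
    next
      case 3
      then have "jumps_left \<omega> \<eta> (p (k + 1) + 1)" using jumps_left_iff[OF p] by simp
      with 3 q show ?thesis
        by (auto simp: p'1 fssep_step_def jumps_right_def jumps_left_def attempts_right_def attempts_left_def)
    qed
  qed
  have "\<exists>k. i = ?p' (k + 1)" if i: "\<not> fssep_step \<omega> \<eta> i" for i
  proof -
    have ex: "\<exists>k. j = p (k + 1)" if "\<not> \<eta> j" for j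
    proof -
      from that p obtain k where "j = p k" by (auto simp: hole_enum_def)
      then show ?thesis by (intro exI[of _ "k - 1"]) simp
    qed
    show ?thesis
    proof (cases "\<eta> i")
      case False
      then obtain k where k: "i = p (k + 1)" using ex by blast
      with i have "\<not> jumps_right \<omega> \<eta> (p (k + 1) - 1)" "\<not> jumps_left \<omega> \<eta> (p (k + 1) + 1)"
        by (auto simp: fssep_step_def)
      then have "?c k = 0" using current_range[of "\<lambda>k. \<omega> (p (k + 1))" "stacks p" k]
        unfolding jumps_right_iff[OF p] jumps_left_iff[OF p] by blast
      with k p'1[of k] show ?thesis by (intro exI[of _ k]) simp
    next
      case True
      with i have "jumps_right \<omega> \<eta> i \<or> jumps_left \<omega> \<eta> i" by (auto simp: fssep_step_def)
      then show ?thesis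
      proof
        assume j: "jumps_right \<omega> \<eta> i"
        then obtain k where k: "i + 1 = p (k + 1)"
          using ex[of "i + 1"] by (auto simp: jumps_right_def attempts_right_def)
        then have "i = p (k + 1) - 1" by simp
        with j jumps_right_iff[OF p, of \<omega> k] p'1[of k] show ?thesis by (intro exI[of _ k]) simp
      next
        assume j: "jumps_left \<omega> \<eta> i"
        then obtain k where k: "i - 1 = p (k + 1)"
          using ex[of "i - 1"] by (auto simp: jumps_left_def attempts_left_def)
        then have "i = p (k + 1) + 1" by simp
        with j jumps_left_iff[OF p, of \<omega> k] p'1[of k] show ?thesis by (intro exI[of _ k]) simp
      qed
    qed
  qed
  moreover have "\<not> fssep_step \<omega> \<eta> (?p' k)" for k using hole[of "k - 1"] by simp
  ultimately show "hole_enum (fssep_step \<omega> \<eta>) ?p'"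
    unfolding hole_enum_def using mono by blast
  show "stacks ?p' = ssm_step (\<lambda>k. \<omega> (p (k + 1))) (stacks p)"
  proof
    fix k
    show "stacks ?p' k = ssm_step (\<lambda>k. \<omega> (p (k + 1))) (stacks p) k"
      using stacks_moved[OF p, of \<omega> k] stacks_int[OF mono, of k] by linarith
  qed
qed

lemma moved_holes_frozen: "frozen (stacks p) k \<Longrightarrow> moved_holes \<omega> p (k + 1) = p (k + 1)"
  by (simp add: moved_holes_def current_frozen)

lemma fssep_step_reflect:
  "reflect (fssep_step \<omega> \<eta>) = fssep_step (\<lambda>i. \<not> \<omega> (- i)) (reflect \<eta>)"
proof
  fix i
  have l: "attempts_left (reflect \<eta>) j \<longleftrightarrow> attempts_right \<eta> (- j)"
    and r: "attempts_right (reflect \<eta>) j \<longleftrightarrow> attempts_left \<eta> (- j)" for j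
    by (auto simp: attempts_left_def attempts_right_def reflect_def)
  have jl: "jumps_left (\<lambda>i. \<not> \<omega> (- i)) (reflect \<eta>) j \<longleftrightarrow> jumps_right \<omega> \<eta> (- j)"
    and jr: "jumps_right (\<lambda>i. \<not> \<omega> (- i)) (reflect \<eta>) j \<longleftrightarrow> jumps_left \<omega> \<eta> (- j)" for j
  proof -
    have "- (j + 1) = - j - 1" "- (j - 1) = - j + 1" "- (j + 2) = - j - 2" "- (j - 2) = - j + 2"
      by simp_all
    then show "jumps_left (\<lambda>i. \<not> \<omega> (- i)) (reflect \<eta>) j \<longleftrightarrow> jumps_right \<omega> \<eta> (- j)"
      "jumps_right (\<lambda>i. \<not> \<omega> (- i)) (reflect \<eta>) j \<longleftrightarrow> jumps_left \<omega> \<eta> (- j)"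
      unfolding jumps_left_def jumps_right_def l r by auto
  qed
  show "reflect (fssep_step \<omega> \<eta>) i = fssep_step (\<lambda>i. \<not> \<omega> (- i)) (reflect \<eta>) i"
  proof -
    have "- (i + 1) = - i - 1" "- (i - 1) = - i + 1" by simp_all
    then show ?thesis unfolding fssep_step_def jl jr by (auto simp: reflect_def)
  qed
qed

text \<open>The index \<open>1 - k\<close> makes stack \<open>k\<close> of the mirror image, between
  the holes \<open>- p (1 - k)\<close> and \<open>- p (- k)\<close>, equal to stack
  \<open>- k\<close>.\<close>

lemma hole_enum_reflect:
  assumes "hole_enum \<eta> p"
  shows "hole_enum (reflect \<eta>) (\<lambda>k. - p (1 - k))" "stacks (\<lambda>k. - p (1 - k)) = reflect (stacks p)"
proof -
  have "strict_mono (\<lambda>k. - p (1 - k))"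
    using assms by (auto simp: hole_enum_def strict_mono_def)
  moreover have "\<not> \<eta> (- i) \<longleftrightarrow> i \<in> range (\<lambda>k. - p (1 - k))" for i
  proof
    assume "\<not> \<eta> (- i)"
    with assms obtain k where "- i = p k" by (auto simp: hole_enum_def)
    then show "i \<in> range (\<lambda>k. - p (1 - k))" by (intro range_eqI[of _ _ "1 - k"]) simp
  next
    assume "i \<in> range (\<lambda>k. - p (1 - k))"
    with hole_enum_hole[OF assms] show "\<not> \<eta> (- i)" by auto
  qed
  ultimately show "hole_enum (reflect \<eta>) (\<lambda>k. - p (1 - k))"
    by (simp add: hole_enum_def reflect_def)
  show "stacks (\<lambda>k. - p (1 - k)) = reflect (stacks p)"
    by (auto simp: fun_eq_iff stacks_def reflect_def algebra_simps)
qed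

lemma hole_enum_exists:
  assumes right: "\<And>m. \<exists>i>m. \<not> \<eta> i" and left: "\<And>m. \<exists>i<m. \<not> \<eta> i"
  shows "\<exists>p. hole_enum \<eta> p"
proof -
  define P where "P = {m::nat. \<not> \<eta> (int m)}"
  define Q where "Q = {m::nat. \<not> \<eta> (- int m - 1)}"
  have P: "infinite P"
    unfolding infinite_nat_iff_unbounded
  proof
    fix m
    obtain i where "i > int m" "\<not> \<eta> i" using right by blast
    then show "\<exists>n>m. n \<in> P" by (intro exI[of _ "nat i"]) (auto simp: P_def)
  qed
  have Q: "infinite Q"
    unfolding infinite_nat_iff_unbounded
  proof
    fix m
    obtain i where "i < - int m - 1" "\<not> \<eta> i" using left by blast
    then show "\<exists>n>m. n \<in> Q" by (intro exI[of _ "nat (- i - 1)"]) (auto simp: Q_def)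
  qed
  \<comment> \<open>Nonnegative holes get the indices from 0 upwards, negative holes those from -1
    downwards.\<close>
  define p where "p k = (if 0 \<le> k then int (enumerate P (nat k)) else - int (enumerate Q (nat (- k - 1))) - 1)"
    for k :: int
  have "p k < p (k + 1)" for k
  proof -
    consider "0 \<le> k" | "k = - 1" | "k < - 1" by linarith
    then show ?thesis
    proof cases
      case 1
      then have "nat k < nat (k + 1)" by simp
      with 1 show ?thesis using enumerate_mono[OF _ P] by (simp add: p_def)
    next
      case 3
      then have "nat (- (k + 1) - 1) < nat (- k - 1)" by simp
      from enumerate_mono[OF this Q] 3 show ?thesis by (simp add: p_def)
    qed (simp add: p_def)
  qed
  then have "strict_mono p" by (rule strict_mono_intI)
  moreover have "\<not> \<eta> (p k)" for k
    using enumerate_in_set[OF P, of "nat k"] enumerate_in_set[OF Q, of "nat (- k - 1)"]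
    by (auto simp: p_def P_def Q_def)
  moreover have "i \<in> range p" if "\<not> \<eta> i" for i
  proof (cases "0 \<le> i")
    case True
    with that have "nat i \<in> P" by (simp add: P_def)
    then obtain m where "nat i = enumerate P m" using range_enumerate[OF P] by blast
    with True show ?thesis by (intro range_eqI[of _ _ "int m"]) (simp add: p_def)
  next
    case False
    with that have "nat (- i - 1) \<in> Q" by (simp add: Q_def)
    then obtain m where "nat (- i - 1) = enumerate Q m" using range_enumerate[OF Q] by blast
    with False show ?thesis by (intro range_eqI[of _ _ "- int m - 1"]) (simp add: p_def)
  qed
  ultimately show ?thesis unfolding hole_enum_def by blast
qed

text \<open>Site-level versions of \<^const>\<open>run_start\<close> and \<^const>\<open>inner_zero\<close>: the run start \<open>k\<close> is
  recorded at the hole separating the stacks \<open>k\<close> and \<open>k + 1\<close>, which does not move.\<close>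

definition hole_run_start :: "(int \<Rightarrow> bool) \<Rightarrow> int \<Rightarrow> bool" where
  "hole_run_start \<eta> q \<longleftrightarrow> \<not> \<eta> q \<and> \<not> (\<eta> (q - 1) \<and> \<eta> (q - 2)) \<and> \<not> (\<eta> (q + 1) \<and> \<eta> (q + 2)) \<and>
     (if \<eta> (q - 1) then \<eta> (q - 3) \<and> \<eta> (q - 4) else \<eta> (q - 2) \<and> \<eta> (q - 3))"

definition hole_inner_zero :: "(int \<Rightarrow> bool) \<Rightarrow> int \<Rightarrow> bool" where
  "hole_inner_zero \<eta> q \<longleftrightarrow> \<not> \<eta> q \<and> \<not> \<eta> (q + 1) \<and> \<not> (\<eta> (q - 1) \<and> \<eta> (q - 2)) \<and>
     \<not> (\<eta> (q + 2) \<and> \<eta> (q + 3))"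

lemma hole_run_start_iff:
  assumes p: "hole_enum \<eta> p"
  shows "hole_run_start \<eta> (p (k + 1)) \<longleftrightarrow> run_start (stacks p) k"
proof (cases "short (stacks p k)")
  case False
  with tall_before_hole[OF p, of k] show ?thesis by (auto simp: hole_run_start_def run_start_def)
next
  case True
  note facts = tall_before_hole[OF p, of k] tall_after_hole[OF p, of "k + 1"]
    tall_before_hole[OF p, of "k - 1"] hole_enum_hole[OF p, of "k + 1"] hole_enum_hole[OF p, of k]
  from True have "stacks p k = 0 \<or> stacks p k = 1" by linarith
  then show ?thesis
  proof
    assume "stacks p k = 0"
    then have "p (k + 1) = p k + 1" using hole_enum_next[OF p, of k] by simp
    with True facts show ?thesis by (auto simp: hole_run_start_def run_start_def)
  next
    assume s: "stacks p k = 1"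
    then have e: "p (k + 1) = p k + 2" using hole_enum_next[OF p, of k] by simp
    then have "\<eta> (p k + 1)" by (intro hole_enum_between[OF p, of k]) auto
    with e True facts show ?thesis by (auto simp: hole_run_start_def run_start_def algebra_simps)
  qed
qed

lemma hole_inner_zero_iff:
  assumes p: "hole_enum \<eta> p"
  shows "hole_inner_zero \<eta> (p k) \<longleftrightarrow> inner_zero (stacks p) k"
proof (cases "stacks p k = 0")
  case True
  then have "p (k + 1) = p k + 1" using hole_enum_next[OF p, of k] by simp
  with True tall_before_hole[OF p, of "k - 1"] tall_after_hole[OF p, of "k + 1"]
    hole_enum_hole[OF p, of k] hole_enum_hole[OF p, of "k + 1"]
  show ?thesis by (auto simp: hole_inner_zero_def inner_zero_def algebra_simps)
next
  case False
  then have "p k + 1 < p (k + 1)" using hole_enum_next[OF p, of k] by simp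
  then have "\<eta> (p k + 1)" by (intro hole_enum_between[OF p, of k]) auto
  with False show ?thesis by (auto simp: hole_inner_zero_def inner_zero_def)
qed

text \<open>Checked on site patterns, since \<open>marker_persists\<close> asks for the spacing in
  every configuration, also in one without a hole enumeration. The bound 4 is twice the displacement
  in \<open>hole_run_start_step\<close>.\<close>

lemma hole_run_start_spacing:
  assumes "hole_run_start \<eta> i" "hole_run_start \<eta> j" "i \<noteq> j"
  shows "\<bar>i - j\<bar> > 4"
proof -
  have "\<not> (hole_run_start \<eta> q \<and> hole_run_start \<eta> (q + d))" if "d \<in> {1, 2, 3, 4}" for q d
    using that by (elim insertE) (auto simp: hole_run_start_def algebra_simps split: if_splits)
  then have *: "\<not> (hole_run_start \<eta> q \<and> hole_run_start \<eta> r)" if "r - q \<in> {1, 2, 3, 4}" for q r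
    using that by (metis add_diff_cancel_left' add.commute diff_add_cancel)
  show ?thesis
  proof (rule ccontr)
    assume "\<not> ?thesis"
    with assms(3) have "j - i \<in> {1, 2, 3, 4} \<or> i - j \<in> {1, 2, 3, 4}" by auto
    with * assms(1,2) show False by blast
  qed
qed

lemma hole_enum_ex: "hole_enum \<eta> p \<Longrightarrow> \<not> \<eta> i \<Longrightarrow> \<exists>k. i = p (k + 1)"
  unfolding hole_enum_def by (metis diff_add_cancel imageE)

text \<open>A run start moves by at most one index, the hole recording the old start does not move,
  and holes separated by a short stack are at most 2 sites apart.\<close>

lemma hole_run_start_step:
  assumes p: "hole_enum \<eta> p" and q: "hole_run_start (fssep_step \<omega> \<eta>) q"
  shows "\<exists>r. \<bar>r - q\<bar> \<le> 2 \<and> hole_run_start \<eta> r"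
proof -
  let ?p' = "moved_holes \<omega> p"
  note step = hole_enum_step[OF p, of \<omega>]
  obtain j where j: "q = ?p' (j + 1)"
    using hole_enum_ex[OF step(1)] q by (auto simp: hole_run_start_def)
  then have rs: "run_start (stacks ?p') j" using q hole_run_start_iff[OF step(1)] by simp
  then obtain i where i: "\<bar>i - j\<bar> \<le> 1" "run_start (stacks p) i"
    using run_start_step unfolding step(2) by blast
  have e: "?p' (i + 1) = p (i + 1)"
    using i(2) by (intro moved_holes_frozen) (simp add: run_start_def frozen_def)
  have "\<bar>?p' (i + 1) - q\<bar> \<le> 2"
  proof -
    from i(1) have "i = j - 1 \<or> i = j \<or> i = j + 1" by linarith
    with rs j hole_enum_next[OF step(1), of j] hole_enum_next[OF step(1), of "j + 1"] show ?thesis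
      by (auto simp: run_start_def)
  qed
  with e i(2) hole_run_start_iff[OF p, of i] show ?thesis by auto
qed

text \<open>Two sites translate back into one index. On the right, a start at \<open>i + 2\<close>
  has a tall stack before it and later starts are at least three holes away; on the left, stack
  \<open>i\<close> has just gained a particle, so hole \<open>i - 1\<close> is at least 3 sites from
  hole \<open>i + 1\<close>.\<close>

lemma run_start_persists:
  assumes p: "hole_enum \<eta> p"
    and persist: "\<And>q. hole_run_start \<eta> q \<Longrightarrow> \<exists>r. \<bar>r - q\<bar> \<le> 2 \<and> hole_run_start (fssep_step \<omega> \<eta>) r"
    and i: "run_start (stacks p) i"
  shows "\<exists>j. \<bar>j - i\<bar> \<le> 1 \<and> run_start (stacks (moved_holes \<omega> p)) j"
proof -
  let ?p' = "moved_holes \<omega> p"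
  let ?n' = "stacks ?p'"
  note step = hole_enum_step[OF p, of \<omega>]
  note nxt = hole_enum_next[OF step(1)]
  have fr: "frozen (stacks p) i" using i by (simp add: run_start_def frozen_def)
  have e: "?p' (i + 1) = p (i + 1)" using fr by (rule moved_holes_frozen)
  have n'i: "?n' i \<ge> 1"
  proof -
    have "ssm_current (\<lambda>k. \<omega> (p (k + 1))) (stacks p) (i - 1) = 1"
      using i by (intro current_tall_short) (auto simp: run_start_def)
    with current_frozen[OF fr, of "\<lambda>k. \<omega> (p (k + 1))"] step_at(1)[of "\<lambda>k. \<omega> (p (k + 1))" "stacks p" i] show ?thesis
      unfolding step(2) by linarith
  qed
  have "hole_run_start \<eta> (p (i + 1))" using i hole_run_start_iff[OF p] by simp
  then obtain r where r: "\<bar>r - ?p' (i + 1)\<bar> \<le> 2" "hole_run_start (fssep_step \<omega> \<eta>) r"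
    using persist unfolding e by blast
  obtain j where j: "r = ?p' (j + 1)"
    using hole_enum_ex[OF step(1)] r by (auto simp: hole_run_start_def)
  then have rs: "run_start ?n' j" using r hole_run_start_iff[OF step(1)] by simp
  have mono: "strict_mono ?p'" using step(1) by (simp add: hole_enum_def)
  have "\<not> i + 1 < j"
  proof
    assume "i + 1 < j"
    then have "j = i + 2 \<or> i + 4 \<le> j + 1" by linarith
    then show False
    proof
      assume "j = i + 2"
      with rs nxt[of "i + 1"] nxt[of "i + 2"] r(1) j show False by (simp add: run_start_def algebra_simps)
    next
      assume "i + 4 \<le> j + 1"
      then have "?p' (i + 4) \<le> ?p' (j + 1)" using mono by (simp add: strict_mono_less_eq)
      with nxt[of "i + 1"] nxt[of "i + 2"] nxt[of "i + 3"] r(1) j show False by (simp add: algebra_simps)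
    qed
  qed
  moreover have "\<not> j < i - 1"
  proof
    assume "j < i - 1"
    then have "?p' (j + 1) \<le> ?p' (i - 1)" using mono by (simp add: strict_mono_less_eq)
    with nxt[of i] nxt[of "i - 1"] n'i r(1) j show False by simp
  qed
  ultimately show ?thesis using rs by (intro exI[of _ j]) linarith
qed

text \<open>The hole of an inner zero belongs to a frozen bond and stays in place, so
  \<open>inner_zero_step\<close> transfers to sites with displacement 0.\<close>

lemma hole_inner_zero_step:
  assumes p: "hole_enum \<eta> p"
    and persist: "\<And>q. hole_run_start \<eta> q \<Longrightarrow> \<exists>r. \<bar>r - q\<bar> \<le> 2 \<and> hole_run_start (fssep_step \<omega> \<eta>) r"
    and q: "hole_inner_zero (fssep_step \<omega> \<eta>) q"
  shows "hole_inner_zero \<eta> q"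
proof -
  let ?p' = "moved_holes \<omega> p"
  note step = hole_enum_step[OF p, of \<omega>]
  obtain k where k: "q = ?p' (k + 1)"
    using hole_enum_ex[OF step(1)] q by (auto simp: hole_inner_zero_def)
  then have "inner_zero (stacks ?p') (k + 1)" using q hole_inner_zero_iff[OF step(1)] by simp
  then have z: "inner_zero (stacks p) (k + 1)"
    unfolding step(2)
    by (rule inner_zero_step) (unfold step(2)[symmetric], rule run_start_persists[OF p persist])
  then have "?p' (k + 1) = p (k + 1)"
    by (intro moved_holes_frozen) (simp add: inner_zero_def frozen_def)
  with z k hole_inner_zero_iff[OF p] show ?thesis by simp
qed

lemma inner_zero_persists:
  assumes p: "hole_enum \<eta> p"
    and persist: "\<And>q. hole_inner_zero \<eta> q \<Longrightarrow> hole_inner_zero (fssep_step \<omega> \<eta>) q"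
    and z: "inner_zero (stacks p) k"
  shows "inner_zero (stacks (moved_holes \<omega> p)) k"
proof -
  have "moved_holes \<omega> p (k - 1 + 1) = p (k - 1 + 1)"
    using z by (intro moved_holes_frozen) (simp add: inner_zero_def frozen_def)
  then show ?thesis
    using z persist[of "p k"] hole_inner_zero_iff[OF p, of k]
      hole_inner_zero_iff[OF hole_enum_step(1)[OF p, of \<omega>], of k] by simp
qed

section \<open>Local dynamics with a translation invariant stationary state\<close>

definition agree :: "int \<Rightarrow> (int \<Rightarrow> 'a) \<Rightarrow> (int \<Rightarrow> 'a) \<Rightarrow> bool" where
  "agree r x y \<longleftrightarrow> (\<forall>i. \<bar>i\<bar> \<le> r \<longrightarrow> x i = y i)"

lemma agree_mono: "agree r x y \<Longrightarrow> s \<le> r \<Longrightarrow> agree s x y"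
  by (simp add: agree_def)

lemma agree_shift: "agree (r + \<bar>k\<bar>) x y \<Longrightarrow> agree r (\<lambda>i. x (i + k)) (\<lambda>i. y (i + k))"
  by (auto simp: agree_def)

lemma agree_iff_map: "agree r x y \<longleftrightarrow> map x [-r..r] = map y [-r..r]"
  by (auto simp: agree_def map_eq_conv abs_le_iff)

lemma cylinder_sets:
  fixes y :: "int \<Rightarrow> 'a::{countable,second_countable_topology,t2_space}"
  shows "{x. agree r y x} \<in> sets borel"
proof -
  have "{x \<in> space borel. \<forall>i\<in>{- r..r}. y i = x i} \<in> sets borel"
  proof (rule sets.sets_Collect_finite_All)
    fix i
    have "(\<lambda>x. x i) -` {y i} \<inter> space borel \<in> sets borel"
      using measurable_sets[OF measurable_site, of "{y i}"] by simp
    then show "{x \<in> space borel. y i = x i} \<in> sets borel"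
      by (simp add: vimage_def eq_commute)
  qed (auto)
  then show ?thesis by (simp add: agree_def abs_le_iff minus_le_iff conj_commute)
qed

text \<open>The values on \<open>[-r..r]\<close> form a list over a countable type, so countably
  many cylinders, one representative for each list, make up the event.\<close>

lemma local_decomposition:
  fixes P :: "(int \<Rightarrow> 'a::countable) \<Rightarrow> bool"
  assumes P: "\<And>x y. agree r x y \<Longrightarrow> P x = P y"
  shows "\<exists>Y. countable Y \<and> (\<forall>y\<in>Y. P y) \<and> {x. P x} = (\<Union>y\<in>Y. {x. agree r y x})"
proof -
  define L where "L = (\<lambda>x. map x [-r..r]) ` {x. P x}"
  define g where "g l = (SOME x. P x \<and> map x [-r..r] = l)" for l
  have g: "P (g l) \<and> map (g l) [-r..r] = l" if l: "l \<in> L" for l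
  proof -
    obtain x where "P x \<and> map x [-r..r] = l" using l unfolding L_def by blast
    then show ?thesis unfolding g_def by (rule someI[of "\<lambda>x. P x \<and> map x [-r..r] = l"])
  qed
  show ?thesis
  proof (intro exI[of _ "g ` L"] conjI)
    show "countable (g ` L)" by (simp add: countable_subset[OF subset_UNIV])
    show "\<forall>y\<in>g ` L. P y" using g by blast
    show "{x. P x} = (\<Union>y\<in>g ` L. {x. agree r y x})"
    proof (rule set_eqI, rule iffI)
      fix x assume x: "x \<in> {x. P x}"
      then have "map x [-r..r] \<in> L" by (auto simp: L_def)
      with g have "agree r (g (map x [-r..r])) x" by (simp add: agree_iff_map)
      with \<open>map x [-r..r] \<in> L\<close> show "x \<in> (\<Union>y\<in>g ` L. {x. agree r y x})" by blast
    next
      fix x assume "x \<in> (\<Union>y\<in>g ` L. {x. agree r y x})"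
      then show "x \<in> {x. P x}" using P g by blast
    qed
  qed
qed

lemma local_sets:
  fixes P :: "(int \<Rightarrow> 'a::{countable,second_countable_topology,t2_space}) \<Rightarrow> bool"
  assumes P: "\<And>x y. agree r x y \<Longrightarrow> P x = P y"
  shows "{x. P x} \<in> sets borel"
proof -
  obtain Y where Y: "countable Y" "{x. P x} = (\<Union>y\<in>Y. {x. agree r y x})"
    using local_decomposition[of r P, OF P] by blast
  show ?thesis unfolding Y(2) using Y(1) by (intro sets.countable_UN'' cylinder_sets)
qed

lemma space_coins: "space coins = UNIV"
  using sets_eq_imp_space_eq[OF sets_coins] by simp

lemma coins_cylinder: "emeasure coins {\<omega>. agree r \<omega>0 \<omega>} \<noteq> 0"
proof -
  interpret product_prob_space "\<lambda>_. measure_pmf (bernoulli_pmf (1/2))" "UNIV :: int set"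
    by unfold_locales
  have "emeasure coins {x \<in> space coins. \<forall>i\<in>{- r..r}. x i \<in> {\<omega>0 i}} =
      (\<Prod>i\<in>{- r..r}. emeasure (measure_pmf (bernoulli_pmf (1/2))) {\<omega>0 i})"
    unfolding coins_def by (rule emeasure_PiM_Collect) auto
  also have "\<dots> = ennreal (\<Prod>i\<in>{- r..r}. pmf (bernoulli_pmf (1/2)) (\<omega>0 i))"
    unfolding emeasure_pmf_single by (rule prod_ennreal) simp
  also have "\<dots> \<noteq> 0"
  proof -
    have "0 < pmf (bernoulli_pmf (1/2)) b" for b by (cases b) simp_all
    then have "0 < (\<Prod>i\<in>{- r..r}. pmf (bernoulli_pmf (1/2)) (\<omega>0 i))" by (intro prod_pos) blast
    then show ?thesis by simp
  qed
  finally have "emeasure coins {x \<in> space coins. \<forall>i\<in>{- r..r}. x i \<in> {\<omega>0 i}} \<noteq> 0" .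
  moreover have "{x \<in> space coins. \<forall>i\<in>{- r..r}. x i \<in> {\<omega>0 i}} = {\<omega>. agree r \<omega>0 \<omega>}"
    by (auto simp: space_coins agree_def abs_le_iff)
  ultimately show ?thesis by simp
qed

lemma coins_shift: "distr coins borel (\<lambda>\<omega> i. \<omega> (i + k)) = coins"
proof -
  have "distr coins coins (\<lambda>\<omega>. \<lambda>n\<in>UNIV. \<omega> (n + k)) = coins"
    unfolding coins_def
    by (rule distr_PiM_reindex[of UNIV "\<lambda>_. measure_pmf (bernoulli_pmf (1/2))" "\<lambda>i. i + k" UNIV])
       (auto intro: prob_space_measure_pmf)
  also have "distr coins coins (\<lambda>\<omega>. \<lambda>n\<in>UNIV. \<omega> (n + k)) = distr coins borel (\<lambda>\<omega> i. \<omega> (i + k))"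
    by (rule distr_cong) (auto simp: sets_coins)
  finally show ?thesis .
qed

lemma measurable_shift:
  "(\<lambda>\<eta> i. \<eta> (i + k)) \<in> borel \<rightarrow>\<^sub>M 
    (borel :: (int \<Rightarrow> 'a::{countable,second_countable_topology,t2_space}) measure)"
  by (rule measurable_configI) (rule measurable_site)

section \<open>The joint law of a stationary state and the coins\<close>

locale tis_dynamics =
  fixes step :: "(int \<Rightarrow> bool) \<Rightarrow> (int \<Rightarrow> 'a::{countable,second_countable_topology,t2_space}) \<Rightarrow> int \<Rightarrow> 'a"
    and \<mu> :: "(int \<Rightarrow> 'a) measure"
  assumes tis: "TIS (\<lambda>n. distr coins borel (\<lambda>\<omega>. step \<omega> n)) \<mu>"
    and measurable_step: "(\<lambda>(n, \<omega>). step \<omega> n) \<in> borel \<Otimes>\<^sub>M borel \<rightarrow>\<^sub>M borel"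
    and step_shift: "\<And>\<omega> n k. step (\<lambda>i. \<omega> (i + k)) (\<lambda>i. n (i + k)) = (\<lambda>i. step \<omega> n (i + k))"
    and step_local: "\<And>r n n' \<omega> \<omega>'. agree (r + 3) n n' \<Longrightarrow> agree (r + 3) \<omega> \<omega>' \<Longrightarrow>
        agree r (step \<omega> n) (step \<omega>' n')"
begin

sublocale prob_space \<mu>
  using tis by (simp add: TIS_def state_def)

sublocale coins: prob_space coins
  by (rule prob_space_coins)

sublocale joint: pair_prob_space \<mu> coins ..

abbreviation "joint \<equiv> \<mu> \<Otimes>\<^sub>M coins"

lemma sets_\<mu>: "sets \<mu> = sets borel"
  using tis by (simp add: TIS_def state_def)

lemma space_\<mu>: "space \<mu> = UNIV"
  using sets_eq_imp_space_eq[OF sets_\<mu>] by simp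

lemma sets_joint: "sets joint = sets (borel \<Otimes>\<^sub>M borel)"
  by (rule sets_pair_measure_cong[OF sets_\<mu> sets_coins])

lemma space_joint: "space joint = UNIV"
  by (simp add: space_pair_measure space_\<mu> space_coins)

lemma \<mu>_shift: "distr \<mu> borel (\<lambda>\<eta> i. \<eta> (i + k)) = \<mu>"
  using tis by (simp add: TIS_def translation_invariant_def)

lemma emeasure_shift:
  assumes "A \<in> sets borel"
  shows "emeasure \<mu> {n. (\<lambda>i. n (i + k)) \<in> A} = emeasure \<mu> A"
proof -
  have "emeasure \<mu> A = emeasure (distr \<mu> borel (\<lambda>\<eta> i. \<eta> (i + k))) A" by (simp add: \<mu>_shift)
  also have "\<dots> = emeasure \<mu> ((\<lambda>\<eta> i. \<eta> (i + k)) -` A \<inter> space \<mu>)"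
    using assms measurable_shift by (intro emeasure_distr) (auto simp: measurable_cong_sets[OF sets_\<mu> refl])
  finally show ?thesis by (simp add: space_\<mu> vimage_def)
qed

lemma joint_shift:
  "distr joint joint (\<lambda>(n, \<omega>). (\<lambda>i. n (i + k), \<lambda>i. \<omega> (i + k))) = joint"
proof -
  have "distr \<mu> borel (\<lambda>\<eta> i. \<eta> (i + k)) \<Otimes>\<^sub>M distr coins borel (\<lambda>\<omega> i. \<omega> (i + k)) =
      distr joint (borel \<Otimes>\<^sub>M borel) (\<lambda>(n, \<omega>). (\<lambda>i. n (i + k), \<lambda>i. \<omega> (i + k)))"
    using measurable_shift[where 'a = 'a] measurable_shift[where 'a = bool]
    by (intro pair_measure_distr)
       (auto simp: measurable_cong_sets[OF sets_\<mu> refl] measurable_cong_sets[OF sets_coins refl]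
         coins_shift intro: coins.sigma_finite_measure_axioms)
  then show ?thesis
    by (simp add: \<mu>_shift coins_shift sets_joint cong: distr_cong)
qed

lemma measurable_step_joint: "(\<lambda>x. step (snd x) (fst x)) \<in> joint \<rightarrow>\<^sub>M borel"
  using measurable_step by (simp add: case_prod_beta' measurable_cong_sets[OF sets_joint refl])

text \<open>Stationarity rewritten on the product of initial state and coins, where the
  configurations before and after a step can be compared.\<close>

lemma emeasure_step:
  assumes A: "A \<in> sets borel"
  shows "emeasure joint {x. step (snd x) (fst x) \<in> A} = emeasure \<mu> A"
proof -
  let ?K = "\<lambda>n. distr coins borel (\<lambda>\<omega>. step \<omega> n)"
  have K: "?K \<in> \<mu> \<rightarrow>\<^sub>M subprob_algebra borel"
    using measurable_prob_algebraD[OF kernel_prob_algebra[OF measurable_step]]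
    by (simp add: measurable_cong_sets[OF sets_\<mu> refl])
  have sec: "(\<lambda>\<omega>. step \<omega> n) \<in> coins \<rightarrow>\<^sub>M borel" for n
    using measurable_compose[OF measurable_Pair1'[of n \<mu> coins] measurable_step_joint]
    by (simp add: space_\<mu>)
  have X: "{x. step (snd x) (fst x) \<in> A} \<in> sets joint"
    using measurable_sets[OF measurable_step_joint A] by (simp add: space_joint vimage_def)
  have "emeasure \<mu> A = emeasure (\<mu> \<bind> ?K) A"
    using tis by (simp add: TIS_def stationary_def)
  also have "\<dots> = (\<integral>\<^sup>+n. emeasure (?K n) A \<partial>\<mu>)"
    by (rule emeasure_bind[OF _ K A]) (simp add: space_\<mu>)
  also have "\<dots> = (\<integral>\<^sup>+n. emeasure coins (Pair n -` {x. step (snd x) (fst x) \<in> A}) \<partial>\<mu>)"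
    by (intro nn_integral_cong) (simp add: emeasure_distr[OF sec A] space_coins vimage_def)
  also have "\<dots> = emeasure joint {x. step (snd x) (fst x) \<in> A}"
    by (rule coins.emeasure_pair_measure_alt[OF X, symmetric])
  finally show ?thesis ..
qed

lemma AE_joint_fst:
  assumes "AE n in \<mu>. P n"
  shows "AE x in joint. P (fst x)"
proof -
  obtain N where N: "\<And>n. n \<in> space \<mu> - N \<Longrightarrow> P n" "N \<in> null_sets \<mu>"
    using AE_E3[OF assms] by blast
  have "emeasure joint (N \<times> space coins) = emeasure \<mu> N * emeasure coins (space coins)"
    using N by (intro coins.emeasure_pair_measure_Times) auto
  then have "N \<times> space coins \<in> null_sets joint" using N by (intro null_setsI) auto
  moreover have "{x \<in> space joint. \<not> P (fst x)} \<subseteq> N \<times> space coins"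
    using N(1) by (fastforce simp: space_\<mu> space_coins)
  ultimately show ?thesis by (rule AE_I')
qed

section \<open>The support, and persistence of markers on it\<close>

definition support :: "(int \<Rightarrow> 'a) set" where
  "support = {n. \<forall>r. emeasure \<mu> {x. agree r n x} \<noteq> 0}"

text \<open>For fixed \<open>r\<close> the bad configurations lie in countably many null cylinders,
  and there are countably many radii.\<close>

lemma AE_support: "AE n in \<mu>. n \<in> support"
proof -
  have "AE n in \<mu>. emeasure \<mu> {x. agree r n x} \<noteq> 0" for r
  proof -
    have "(emeasure \<mu> {x. agree r n x} = 0) = (emeasure \<mu> {x. agree r n' x} = 0)"
      if "agree r n n'" for n n' :: "int \<Rightarrow> 'a"
    proof -
      have "agree r n x = agree r n' x" for x using that by (simp add: agree_def)
      then show ?thesis by simp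
    qed
    from local_decomposition[of r "\<lambda>n. emeasure \<mu> {x. agree r n x} = 0", OF this] obtain Y where
      Y: "countable Y" "\<forall>y\<in>Y. emeasure \<mu> {x. agree r y x} = 0"
        "{n. emeasure \<mu> {x. agree r n x} = 0} = (\<Union>y\<in>Y. {x. agree r y x})" by blast
    have "{n. emeasure \<mu> {x. agree r n x} = 0} \<in> null_sets \<mu>"
      unfolding Y(3) using Y(1,2) by (intro null_sets_UN' null_setsI) (auto simp: sets_\<mu> cylinder_sets)
    then show ?thesis by (rule AE_I') auto
  qed
  then have "AE n in \<mu>. \<forall>r. emeasure \<mu> {x. agree r n x} \<noteq> 0" by (simp add: AE_all_countable)
  then show ?thesis by (simp add: support_def)
qed

lemma support_shift:
  assumes n: "n \<in> support"
  shows "(\<lambda>i. n (i + k)) \<in> support"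
proof -
  have "emeasure \<mu> {x. agree r (\<lambda>i. n (i + k)) x} \<noteq> 0" for r
  proof
    assume z: "emeasure \<mu> {x. agree r (\<lambda>i. n (i + k)) x} = 0"
    have "emeasure \<mu> {y. agree r (\<lambda>i. n (i + k)) (\<lambda>i. y (i + k))} = 0"
      using emeasure_shift[OF cylinder_sets[of r "\<lambda>i. n (i + k)"], of k] z by simp
    moreover have "emeasure \<mu> {y. agree (r + \<bar>k\<bar>) n y} \<le>
        emeasure \<mu> {y. agree r (\<lambda>i. n (i + k)) (\<lambda>i. y (i + k))}"
    proof (rule emeasure_mono)
      show "{y. agree r (\<lambda>i. n (i + k)) (\<lambda>i. y (i + k))} \<in> sets \<mu>"
        unfolding sets_\<mu>
      proof (rule local_sets[of "r + \<bar>k\<bar>"])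
        fix x y :: "int \<Rightarrow> 'a" assume "agree (r + \<bar>k\<bar>) x y"
        then have "agree r (\<lambda>i. x (i + k)) (\<lambda>i. y (i + k))" by (rule agree_shift)
        then show "agree r (\<lambda>i. n (i + k)) (\<lambda>i. x (i + k)) = agree r (\<lambda>i. n (i + k)) (\<lambda>i. y (i + k))"
          by (simp add: agree_def)
      qed
    qed (auto intro: agree_shift)
    ultimately show False using n by (simp add: support_def)
  qed
  then show ?thesis by (simp add: support_def)
qed

lemma support_box:
  assumes "n \<in> support"
  shows "emeasure joint ({x. agree r n x} \<times> {x. agree r \<omega> x}) \<noteq> 0"
    and "{x. agree r n x} \<times> {x. agree r \<omega> x} \<in> sets joint"
proof -
  have s: "{x. agree r n x} \<in> sets \<mu>" "{x. agree r \<omega> x} \<in> sets coins"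
    by (simp_all add: sets_\<mu> sets_coins cylinder_sets)
  then show "{x. agree r n x} \<times> {x. agree r \<omega> x} \<in> sets joint" by auto
  have "emeasure \<mu> {x. agree r n x} \<noteq> 0" using assms by (simp add: support_def)
  with coins_cylinder[of r \<omega>] show "emeasure joint ({x. agree r n x} \<times> {x. agree r \<omega> x}) \<noteq> 0"
    by (simp add: coins.emeasure_pair_measure_Times[OF s])
qed

text \<open>All pairs close enough to \<open>n\<close> and \<open>\<omega>\<close> step into a given
  cylinder around \<open>step \<omega> n\<close>, and the box of such pairs has positive mass
  because every coin cylinder does.\<close>

lemma support_step:
  assumes n: "n \<in> support"
  shows "step \<omega> n \<in> support"
proof -
  have "emeasure \<mu> {x. agree r (step \<omega> n) x} \<noteq> 0" for r
  proof -
    let ?A = "{x. agree r (step \<omega> n) x}"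
    have A: "?A \<in> sets borel" by (rule cylinder_sets)
    have "emeasure joint ({x. agree (r + 3) n x} \<times> {x. agree (r + 3) \<omega> x}) \<le>
        emeasure joint {x. step (snd x) (fst x) \<in> ?A}"
    proof (rule emeasure_mono)
      show "{x. step (snd x) (fst x) \<in> ?A} \<in> sets joint"
        using measurable_sets[OF measurable_step_joint A] by (simp add: space_joint vimage_def)
    qed (auto intro: step_local)
    also have "\<dots> = emeasure \<mu> ?A" by (rule emeasure_step[OF A])
    finally show ?thesis using support_box(1)[OF n, of "r + 3" \<omega>] by auto
  qed
  then show ?thesis by (simp add: support_def)
qed

text \<open>A failure at \<open>n\<close> and \<open>\<omega>\<close> would extend to a box of
  positive mass. This turns almost sure statements into statements about every choice of coins, as
  steering requires.\<close>

lemma support_AE_local: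
  assumes n: "n \<in> support"
    and loc: "\<And>n n' \<omega> \<omega>'. agree r n n' \<Longrightarrow> agree r \<omega> \<omega>' \<Longrightarrow> P n \<omega> = P n' \<omega>'"
    and ae: "AE x in joint. P (fst x) (snd x)"
  shows "P n \<omega>"
proof (rule ccontr)
  assume not: "\<not> P n \<omega>"
  let ?B = "{x. agree r n x} \<times> {x. agree r \<omega> x}"
  have "AE x in joint. x \<notin> ?B"
    using ae by eventually_elim (use loc not in auto)
  then have "?B \<in> null_sets joint" using support_box(2)[OF n] by (simp add: AE_iff_null_sets)
  with support_box(1)[OF n] show False by (metis null_setsD1)
qed

text \<open>Mass transport: new markers inject into old ones, and by stationarity there are equally many.\<close>

lemma marker_persists:
  fixes M :: "(int \<Rightarrow> 'a) \<Rightarrow> int \<Rightarrow> bool" and d :: int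
  assumes loc: "\<And>n n'. agree r n n' \<Longrightarrow> M n 0 = M n' 0"
    and shift: "\<And>n i k. M (\<lambda>j. n (j + k)) i = M n (i + k)"
    and spacing: "\<And>n i j. M n i \<Longrightarrow> M n j \<Longrightarrow> i \<noteq> j \<Longrightarrow> \<bar>i - j\<bar> > 2 * d"
    and origin: "AE n in \<mu>. \<forall>\<omega> j. M (step \<omega> n) j \<longrightarrow> (\<exists>i. \<bar>i - j\<bar> \<le> d \<and> M n i)"
    and n: "n \<in> support" and i: "M n i"
  shows "\<exists>j. \<bar>j - i\<bar> \<le> d \<and> M (step \<omega> n) j"
proof -
  have locM: "M n i = M n' i" if "agree (r + \<bar>i\<bar>) n n'" for n n' i
    using loc[OF agree_shift[OF that]] shift[of n i 0] shift[of n' i 0] by simp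
  have M_sets: "{n. M n i} \<in> sets borel" for i by (rule local_sets[OF locM])
  define A where "A j = {x. M (step (snd x) (fst x)) j}" for j
  define B where "B i = {x :: (int \<Rightarrow> 'a) \<times> (int \<Rightarrow> bool). M (fst x) i}" for i
  have A_sets: "A j \<in> sets joint" for j
    using measurable_sets[OF measurable_step_joint M_sets[of j]] by (simp add: A_def space_joint vimage_def)
  have "fst -` {n. M n i} \<inter> space joint \<in> sets joint" for i
    by (rule measurable_sets[OF measurable_fst]) (simp add: sets_\<mu> M_sets)
  then have B_sets: "B i \<in> sets joint" for i by (simp add: B_def space_joint vimage_def)
  have AB: "joint.prob (A 0) = joint.prob (B 0)"
  proof -
    have "emeasure joint (A 0) = emeasure \<mu> {n. M n 0}"
      using emeasure_step[OF M_sets[of 0]] by (simp add: A_def)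
    moreover have "emeasure joint (B 0) = emeasure \<mu> {n. M n 0}"
    proof -
      have "B 0 = {n. M n 0} \<times> space coins" by (auto simp: B_def space_coins)
      then show ?thesis
        by (simp add: coins.emeasure_pair_measure_Times sets_\<mu> M_sets coins.emeasure_space_1)
    qed
    ultimately show ?thesis by (simp add: measure_def)
  qed
  \<comment> \<open>The mass sent from \<open>k\<close> to the origin equals the mass sent from the
    origin to \<open>- k\<close>.\<close>
  have shifted: "joint.prob (A 0 \<inter> B k) = joint.prob (A (- k) \<inter> B 0)" for k
  proof -
    let ?f = "\<lambda>(n, \<omega>). (\<lambda>i. n (i + k), \<lambda>i. \<omega> (i + k)) :: (int \<Rightarrow> 'a) \<times> (int \<Rightarrow> bool)"
    have f: "?f \<in> joint \<rightarrow>\<^sub>M joint"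
    proof -
      have "(\<lambda>x. (\<lambda>i. fst x (i + k), \<lambda>i. snd x (i + k))) \<in> borel \<Otimes>\<^sub>M borel \<rightarrow>\<^sub>M
          (borel \<Otimes>\<^sub>M borel :: ((int \<Rightarrow> 'a) \<times> (int \<Rightarrow> bool)) measure)"
        by (intro measurable_Pair measurable_compose[OF measurable_fst measurable_shift]
             measurable_compose[OF measurable_snd measurable_shift])
      then show ?thesis by (simp add: case_prod_beta' measurable_cong_sets[OF sets_joint sets_joint])
    qed
    have "measure joint (A (- k) \<inter> B 0) = measure (distr joint joint ?f) (A (- k) \<inter> B 0)"
      by (simp add: joint_shift)
    also have "\<dots> = measure joint (?f -` (A (- k) \<inter> B 0) \<inter> space joint)"
      by (rule measure_distr[OF f]) (intro sets.Int A_sets B_sets)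
    also have "?f -` (A (- k) \<inter> B 0) \<inter> space joint = A 0 \<inter> B k"
      by (auto simp: A_def B_def space_joint step_shift shift)
    finally show ?thesis ..
  qed
  have A0: "AE x in joint. x \<in> A 0 \<longrightarrow> x \<in> (\<Union>k\<in>{- d..d}. A 0 \<inter> B k)"
    using AE_joint_fst[OF origin]
  proof eventually_elim
    case (elim x)
    show ?case
    proof
      assume a: "x \<in> A 0"
      with elim obtain k where "\<bar>k - 0\<bar> \<le> d" "M (fst x) k" unfolding A_def by blast
      with a show "x \<in> (\<Union>k\<in>{- d..d}. A 0 \<inter> B k)" by (auto simp: B_def abs_le_iff)
    qed
  qed
  let ?U = "\<Union>k\<in>{- d..d}. A (- k) \<inter> B 0"
  have U_sets: "?U \<in> sets joint" using A_sets B_sets by auto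
  \<comment> \<open>The chain bounds the probability of an old marker at the origin by that of the
    subevent \<open>?U\<close> on which a new marker lies within \<open>d\<close>; the spacing of
    new markers makes the union disjoint. Equality forces the difference to be null.\<close>
  have "joint.prob (B 0) = joint.prob (A 0)" by (simp add: AB)
  also have "\<dots> \<le> joint.prob (\<Union>k\<in>{- d..d}. A 0 \<inter> B k)"
    using A0 A_sets B_sets by (intro joint.finite_measure_mono_AE) auto
  also have "\<dots> \<le> (\<Sum>k\<in>{- d..d}. joint.prob (A 0 \<inter> B k))"
    using A_sets B_sets by (intro joint.finite_measure_subadditive_finite) auto
  also have "\<dots> = (\<Sum>k\<in>{- d..d}. joint.prob (A (- k) \<inter> B 0))" by (simp add: shifted)
  also have "\<dots> = joint.prob ?U"
  proof (rule joint.finite_measure_finite_Union[symmetric])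
    show "disjoint_family_on (\<lambda>k. A (- k) \<inter> B 0) {- d..d}"
      unfolding disjoint_family_on_def
    proof (intro ballI impI)
      fix k l assume kl: "k \<in> {- d..d}" "l \<in> {- d..d}" "k \<noteq> l"
      show "(A (- k) \<inter> B 0) \<inter> (A (- l) \<inter> B 0) = {}"
      proof (rule equals0I)
        fix x assume "x \<in> (A (- k) \<inter> B 0) \<inter> (A (- l) \<inter> B 0)"
        then have "\<bar>- k - (- l)\<bar> > 2 * d" using kl(3) by (intro spacing) (auto simp: A_def)
        with kl show False by auto
      qed
    qed
  qed (use A_sets B_sets in auto)
  finally have "joint.prob (B 0 - ?U) = 0"
    using joint.finite_measure_Diff[OF B_sets[of 0] U_sets] joint.finite_measure_mono[OF _ B_sets[of 0], of ?U]
    by auto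
  then have "emeasure joint (B 0 - ?U) = 0" by (simp add: joint.emeasure_eq_measure)
  then have "B 0 - ?U \<in> null_sets joint" using B_sets U_sets by (intro null_setsI) auto
  then have ae: "AE x in joint. x \<notin> B 0 - ?U" using B_sets U_sets by (subst AE_iff_null_sets[symmetric]) auto
  define P where "P n \<omega> \<longleftrightarrow> (M n 0 \<longrightarrow> (\<exists>j. \<bar>j\<bar> \<le> d \<and> M (step \<omega> n) j))" for n \<omega>
  have P: "P n \<omega>" if "n \<in> support" for n \<omega>
  \<comment> \<open>A marker at \<open>j\<close> after the step is decided within radius
    \<open>r + \<bar>j\<bar>\<close>, and the step itself looks 3 sites further.\<close>
  proof (rule support_AE_local[where P = P and r = "\<bar>r\<bar> + \<bar>d\<bar> + 3", OF that])
    fix n n' :: "int \<Rightarrow> 'a" and \<omega> \<omega>' :: "int \<Rightarrow> bool" assume ag: "agree (\<bar>r\<bar> + \<bar>d\<bar> + 3) n n'" "agree (\<bar>r\<bar> + \<bar>d\<bar> + 3) \<omega> \<omega>'"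
    have "M n 0 = M n' 0" by (rule loc) (rule agree_mono[OF ag(1)], simp)
    moreover have "M (step \<omega> n) j = M (step \<omega>' n') j" if "\<bar>j\<bar> \<le> d" for j
    proof -
      have "r + \<bar>j\<bar> \<le> \<bar>r\<bar> + \<bar>d\<bar>" using that by linarith
      then show ?thesis by (rule locM[OF agree_mono[OF step_local[OF ag]]])
    qed
    ultimately show "P n \<omega> = P n' \<omega>'" unfolding P_def by blast
  next
    show "AE x in joint. P (fst x) (snd x)"
      using ae
    proof eventually_elim
      case (elim x)
      show ?case
        unfolding P_def
      proof
        assume "M (fst x) 0"
        with elim obtain k where "k \<in> {- d..d}" "x \<in> A (- k)" by (auto simp: B_def)
        then show "\<exists>j. \<bar>j\<bar> \<le> d \<and> M (step (snd x) (fst x)) j"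
          by (intro exI[of _ "- k"]) (auto simp: A_def)
      qed
    qed
  qed
  have "P (\<lambda>j. n (j + i)) (\<lambda>j. \<omega> (j + i))" by (rule P[OF support_shift[OF n]])
  with i obtain j where "\<bar>j\<bar> \<le> d" "M (step \<omega> n) (j + i)"
    unfolding P_def step_shift shift by auto
  then show ?thesis by (intro exI[of _ "j + i"]) simp
qed

end

section \<open>The stack model\<close>

lemma config_density_lower:
  fixes \<rho> c :: real
  assumes "config_density occ \<eta> \<rho>" "c < \<rho>"
  shows "\<exists>K. \<forall>N\<ge>K. c * real N \<le> (\<Sum>i = 1..int N. occ (\<eta> i))"
    and "\<exists>K. \<forall>N\<ge>K. c * real N \<le> (\<Sum>i = - int N..- 1. occ (\<eta> i))"
proof -
  have main: "\<exists>K. \<forall>N\<ge>K. c * real N \<le> f N"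
    if lim: "(\<lambda>N. f N / real N) \<longlonglongrightarrow> \<rho>" for f :: "nat \<Rightarrow> real"
  proof -
    have "\<forall>\<^sub>F N in sequentially. c < f N / real N" using lim assms(2) by (rule order_tendstoD)
    then have "\<forall>\<^sub>F N in sequentially. c * real N \<le> f N"
      using eventually_gt_at_top[of 0]
      by eventually_elim (simp add: pos_less_divide_eq less_imp_le)
    then show ?thesis by (simp add: eventually_sequentially)
  qed
  show "\<exists>K. \<forall>N\<ge>K. c * real N \<le> (\<Sum>i = 1..int N. occ (\<eta> i))"
    and "\<exists>K. \<forall>N\<ge>K. c * real N \<le> (\<Sum>i = - int N..- 1. occ (\<eta> i))"
    using assms(1) by (auto simp: config_density_def intro!: main)
qed

lemma eventually_linear_above:
  fixes a b :: real
  assumes "0 < a"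
  shows "\<exists>K::nat. \<forall>N\<ge>K. C < a * real N - b"
proof -
  obtain K :: nat where K: "(C + b) / a < real K" using reals_Archimedean2 by blast
  have "C < a * real N - b" if "K \<le> N" for N
  proof -
    have "(C + b) / a < real N" using K that by linarith
    then show ?thesis using assms by (simp add: pos_divide_less_eq algebra_simps)
  qed
  then show ?thesis by blast
qed

lemma sum_excess_right:
  assumes "is_height n h"
  shows "h (int N) = h 0 + (\<Sum>i = 1..int N. int (n i)) - int N"
proof (induction N)
  case (Suc N)
  have "{1..int (Suc N)} = insert (int N + 1) {1..int N}" by auto
  with Suc height_succ[OF assms, of "int N"] show ?case by (simp add: add.commute)
qed simp

text \<open>Starting from \<open>h (- 1)\<close> leaves out stack 0, which belongs to neither sum in
  \<open>config_density\<close>.\<close>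

lemma sum_excess_left:
  assumes "is_height n h"
  shows "h (- 1 - int N) = h (- 1) - (\<Sum>i = - int N..- 1. int (n i)) + int N"
proof (induction N)
  case (Suc N)
  have "{- int (Suc N)..- 1} = insert (- 1 - int N) {- int N..- 1}" by auto
  with Suc assms[unfolded is_height_def, rule_format, of "- 1 - int N"] show ?case
    by (simp add: algebra_simps)
qed simp

text \<open>The mean slope of the height is \<open>\<rho> - 1 > 0\<close>; the slope
  \<open>c - 1\<close>, with \<open>c\<close> midway between 1 and \<open>\<rho>\<close>, is
  exceeded on all large scales.\<close>

lemma ssm_height_limits:
  assumes dens: "config_density real n \<rho>" "1 < \<rho>" and h: "is_height n h"
  shows "\<exists>K. \<forall>k\<ge>K. C < h k" "\<exists>K. \<forall>k\<le>K. h k < C"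
proof -
  define c where "c = (1 + \<rho>) / 2"
  have c: "1 < c" "c < \<rho>" using dens(2) by (auto simp: c_def)
  obtain K1 where K1: "\<forall>N\<ge>K1. c * real N \<le> (\<Sum>i = 1..int N. real (n i))"
    using config_density_lower(1)[OF dens(1) c(2)] by blast
  obtain K2 where K2: "\<forall>N\<ge>K2. c * real N \<le> (\<Sum>i = - int N..- 1. real (n i))"
    using config_density_lower(2)[OF dens(1) c(2)] by blast
  obtain L1 :: nat where L1: "\<forall>N\<ge>L1. real_of_int C < (c - 1) * real N - real_of_int (- h 0)"
    using eventually_linear_above[of "c - 1"] c by fastforce
  obtain L2 :: nat where L2: "\<forall>N\<ge>L2. real_of_int (- C) < (c - 1) * real N - real_of_int (h (- 1))"
    using eventually_linear_above[of "c - 1"] c by fastforce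
  have "C < h k" if "k \<ge> int (max K1 L1)" for k
  proof -
    define N where "N = nat k"
    have N: "k = int N" "N \<ge> K1" "N \<ge> L1" using that by (auto simp: N_def)
    have "real_of_int (h k) = real_of_int (h 0) + (\<Sum>i = 1..int N. real (n i)) - real N"
      unfolding N(1) sum_excess_right[OF h] by simp
    also have "\<dots> \<ge> real_of_int (h 0) + c * real N - real N" using K1 N(2) by simp
    finally have "real_of_int C < real_of_int (h k)"
      using L1[rule_format, OF N(3)] by (simp add: algebra_simps)
    then show ?thesis by simp
  qed
  then show "\<exists>K. \<forall>k\<ge>K. C < h k" by blast
  have "h k < C" if "k \<le> - 1 - int (max K2 L2)" for k
  proof -
    define N where "N = nat (- 1 - k)"
    have N: "k = - 1 - int N" "N \<ge> K2" "N \<ge> L2" using that by (auto simp: N_def)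
    have "real_of_int (h k) = real_of_int (h (- 1)) - (\<Sum>i = - int N..- 1. real (n i)) + real N"
      unfolding N(1) sum_excess_left[OF h] by simp
    also have "\<dots> \<le> real_of_int (h (- 1)) - c * real N + real N" using K2 N(2) by simp
    finally have "real_of_int (h k) < real_of_int C"
      using L2[rule_format, OF N(3)] by (simp add: algebra_simps)
    then show ?thesis by simp
  qed
  then show "\<exists>K. \<forall>k\<le>K. h k < C" by blast
qed

lemma height_exists: "\<exists>h. is_height n h"
proof -
  \<comment> \<open>Normalised by \<open>h 0 = 0\<close>; for every \<open>k\<close> at least one of
    the two sums is empty.\<close>
  define h where "h k = (\<Sum>i\<in>{0<..k}. int (n i) - 1) - (\<Sum>i\<in>{k<..0}. int (n i) - 1)" for k :: int
  have "h k = h (k - 1) + int (n k) - 1" for k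
  proof (cases "k \<le> 0")
    case True
    then have "{k - 1<..0} = insert k {k<..0}" "{0<..k} = {}" "{0<..k - 1} = {}" by auto
    then show ?thesis by (simp add: h_def)
  next
    case False
    then have "{0<..k} = insert k {0<..k - 1}" "{k<..0} = {}" "{k - 1<..0} = {}" by auto
    then show ?thesis by (simp add: h_def)
  qed
  then show ?thesis unfolding is_height_def by blast
qed

section \<open>Both models as instances of the local dynamics\<close>

lemma ssm_kernel_eq: "ssm_kernel = (\<lambda>n. distr coins borel (\<lambda>\<omega>. ssm_step \<omega> n))"
  by (simp add: fun_eq_iff ssm_kernel_def)

lemma fssep_kernel_eq: "fssep_kernel = (\<lambda>n. distr coins borel (\<lambda>\<omega>. fssep_step \<omega> n))"
  by (simp add: fun_eq_iff fssep_kernel_def)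

lemma tis_dynamics_ssm:
  assumes "TIS ssm_kernel \<mu>"
  shows "tis_dynamics ssm_step \<mu>"
proof
  show "TIS (\<lambda>n. distr coins borel (\<lambda>\<omega>. ssm_step \<omega> n)) \<mu>"
    using assms by (simp add: ssm_kernel_eq)
  show "(\<lambda>(n, \<omega>). ssm_step \<omega> n) \<in> borel \<Otimes>\<^sub>M borel \<rightarrow>\<^sub>M borel" by (rule measurable_ssm_step)
  show "ssm_step (\<lambda>i. \<omega> (i + k)) (\<lambda>i. n (i + k)) = (\<lambda>i. ssm_step \<omega> n (i + k))" for \<omega> n k
  proof -
    have "ssm_current (\<lambda>i. \<omega> (i + k)) (\<lambda>i. n (i + k)) j = ssm_current \<omega> n (j + k)" for j
    proof -
      have "j + k + 1 = j + 1 + k" by simp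
      then show ?thesis by (simp only: ssm_current_def)
    qed
    moreover have "j - 1 + k = j + k - 1" for j by simp
    ultimately show ?thesis by (simp only: ssm_step_def fun_eq_iff simp_thms)
  qed
  show "agree r (ssm_step \<omega> n) (ssm_step \<omega>' n')"
    if "agree (r + 3) n n'" "agree (r + 3) \<omega> \<omega>'" for r n n' \<omega> \<omega>'
    unfolding agree_def
  proof (intro allI impI)
    fix i :: int assume "\<bar>i\<bar> \<le> r"
    then have "n j = n' j \<and> \<omega> j = \<omega>' j" if "j \<in> {i - 1, i, i + 1}" for j
      using \<open>agree (r + 3) n n'\<close> \<open>agree (r + 3) \<omega> \<omega>'\<close> that by (auto simp: agree_def)
    then show "ssm_step \<omega> n i = ssm_step \<omega>' n' i"
      by (simp add: ssm_step_def ssm_current_def)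
  qed
qed

text \<open>The range 3 in the locale comes from this model: whether the particle at
  \<open>i\<close> jumps right depends on its competitor at \<open>i + 2\<close>, whose attempt
  depends on site \<open>i + 3\<close>.\<close>

lemma tis_dynamics_fssep:
  assumes "TIS fssep_kernel \<mu>"
  shows "tis_dynamics fssep_step \<mu>"
proof
  show "TIS (\<lambda>n. distr coins borel (\<lambda>\<omega>. fssep_step \<omega> n)) \<mu>"
    using assms by (simp add: fssep_kernel_eq)
  show "(\<lambda>(n, \<omega>). fssep_step \<omega> n) \<in> borel \<Otimes>\<^sub>M borel \<rightarrow>\<^sub>M borel" by (rule measurable_fssep_step)
  note defs = fssep_step_def jumps_right_def jumps_left_def attempts_right_def attempts_left_def
  show "fssep_step (\<lambda>i. \<omega> (i + k)) (\<lambda>i. n (i + k)) = (\<lambda>i. fssep_step \<omega> n (i + k))" for \<omega> n k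
    unfolding defs by (simp add: algebra_simps)
  show "agree r (fssep_step \<omega> n) (fssep_step \<omega>' n')"
    if "agree (r + 3) n n'" "agree (r + 3) \<omega> \<omega>'" for r n n' \<omega> \<omega>'
    unfolding agree_def
  proof (intro allI impI)
    fix i :: int assume "\<bar>i\<bar> \<le> r"
    then have e: "n j = n' j" "\<omega> j = \<omega>' j" if "\<bar>j - i\<bar> \<le> 3" for j
      using \<open>agree (r + 3) n n'\<close> \<open>agree (r + 3) \<omega> \<omega>'\<close> that by (auto simp: agree_def)
    show "fssep_step \<omega> n i = fssep_step \<omega>' n' i"
      unfolding defs by (simp add: e)
  qed
qed

lemma reflect_shift: "reflect (\<lambda>j. n (j + k)) = (\<lambda>j. reflect n (j - k))"
  by (simp add: fun_eq_iff reflect_def algebra_simps)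

lemma run_start_shift: "run_start (\<lambda>j. n (j + k)) i = run_start n (i + k)"
  by (simp add: run_start_def algebra_simps)

lemma agree_reflect: "agree r n n' \<Longrightarrow> agree r (reflect n) (reflect n')"
  by (simp add: agree_def reflect_def)

lemma ssm_no_frozen_bond:
  assumes "TIS ssm_kernel \<mu>" "has_density real \<mu> \<rho>" "1 < \<rho>"
  shows "AE n in \<mu>. \<forall>k. \<not> frozen n k"
proof -
  interpret tis_dynamics ssm_step \<mu> by (rule tis_dynamics_ssm[OF assms(1)])
  have loc: "run_start n 0 = run_start n' 0" if "agree 1 n n'" for n n'
    using that by (simp add: run_start_def agree_def)
  have starts: "\<exists>j. \<bar>j - i\<bar> \<le> 1 \<and> run_start (ssm_step \<omega> n) j"
    if "n \<in> support" "run_start n i" for n \<omega> i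
  proof (rule marker_persists[where M = run_start and r = 1, OF loc _ _ _ that])
    show "\<bar>i - j\<bar> > 2 * 1" if "run_start n i" "run_start n j" "i \<noteq> j" for n i j
      using run_start_spacing[OF that] by simp
  qed (use run_start_step in \<open>auto simp: run_start_shift\<close>)
  have ends: "\<exists>j. \<bar>j - i\<bar> \<le> 1 \<and> run_start (reflect (ssm_step \<omega> n)) j"
    if n: "n \<in> support" "run_start (reflect n) i" for n \<omega> i
  proof -
    have "\<exists>j. \<bar>j - (- i)\<bar> \<le> 1 \<and> run_start (reflect (ssm_step \<omega> n)) (- j)"
    \<comment> \<open>The sign in \<open>- i\<close> makes this marker move along with a translation
      of the configuration.\<close>
    proof (rule marker_persists[where M = "\<lambda>n i. run_start (reflect n) (- i)" and r = 1, OF _ _ _ _ n(1)])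
      show "run_start (reflect n) (- 0) = run_start (reflect n') (- 0)" if "agree 1 n n'" for n n' :: "int \<Rightarrow> nat"
        using loc[OF agree_reflect[OF that]] by simp
      show "run_start (reflect (\<lambda>j. n (j + k))) (- i) = run_start (reflect n) (- (i + k))" for n i k
        using run_start_shift[of "reflect n" "- k" "- i"] by (simp add: reflect_shift)
      show "\<bar>i - j\<bar> > 2 * 1"
        if "run_start (reflect n) (- i)" "run_start (reflect n) (- j)" "i \<noteq> j" for n i j
        using run_start_spacing[OF that(1,2)] that(3) by linarith
      have "\<exists>i. \<bar>i - j\<bar> \<le> 1 \<and> run_start (reflect n) (- i)"
        if j: "run_start (reflect (ssm_step \<omega> n)) (- j)" for n \<omega> j
      proof -
        obtain i where "\<bar>i - (- j)\<bar> \<le> 1" "run_start (reflect n) i"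
          using run_start_step j unfolding ssm_step_reflect by blast
        then show ?thesis by (intro exI[of _ "- i"]) auto
      qed
      then show "AE n in \<mu>. \<forall>\<omega> j. run_start (reflect (ssm_step \<omega> n)) (- j) \<longrightarrow>
          (\<exists>i. \<bar>i - j\<bar> \<le> 1 \<and> run_start (reflect n) (- i))" by auto
    qed (use n in simp)
    then obtain j where "\<bar>j - (- i)\<bar> \<le> 1" "run_start (reflect (ssm_step \<omega> n)) (- j)" by blast
    then show ?thesis by (intro exI[of _ "- j"]) auto
  qed
  have zeros: "inner_zero (ssm_step \<omega> n) i" if n: "n \<in> support" "inner_zero n i" for n \<omega> i
  proof -
    \<comment> \<open>Inner zeros have displacement 0. Their origin needs the persistence of starts,
      which is already known on the support.\<close>
    have "\<exists>j. \<bar>j - i\<bar> \<le> 0 \<and> inner_zero (ssm_step \<omega> n) j"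
    proof (rule marker_persists[where M = inner_zero and r = 1, OF _ _ _ _ n])
      show "inner_zero n 0 = inner_zero n' 0" if "agree 1 n n'" for n n'
        using that by (simp add: inner_zero_def agree_def)
      show "AE n in \<mu>. \<forall>\<omega> j. inner_zero (ssm_step \<omega> n) j \<longrightarrow> (\<exists>i. \<bar>i - j\<bar> \<le> 0 \<and> inner_zero n i)"
        using AE_support by eventually_elim (use inner_zero_step starts in auto)
    qed (auto simp: inner_zero_def algebra_simps)
    then show ?thesis by simp
  qed
  show ?thesis
    using AE_support assms(2)[unfolded has_density_def]
  proof eventually_elim
    case (elim n)
    obtain h where h: "is_height n h" using height_exists by blast
    show ?case
    proof
      fix k
      show "\<not> frozen n k"
        by (rule no_frozen_bond[where S = support, OF support_step starts ends zeros elim(1) h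
              ssm_height_limits(2,1)[OF elim(2) assms(3) h]])
    qed
  qed
qed

section \<open>The exclusion process\<close>

context tis_dynamics
begin

text \<open>A site singled out in a translation covariant way would be equally likely to be any
  integer, which is impossible for a probability measure.\<close>

lemma AE_no_unique_site:
  assumes sets: "{n. P n 0} \<in> sets borel"
    and shift: "\<And>n i k. P (\<lambda>j. n (j + k)) i = P n (i + k)"
    and unique: "\<And>n i j. P n i \<Longrightarrow> P n j \<Longrightarrow> i = j"
  shows "AE n in \<mu>. \<forall>i. \<not> P n i"
proof -
  define A where "A i = {n. P n i}" for i
  have A_shift: "A i = {n. (\<lambda>j. n (j + i)) \<in> A 0}" for i by (simp add: A_def shift)
  have A_sets: "A i \<in> sets \<mu>" for i
  proof -
    have "(\<lambda>n j. n (j + i)) -` A 0 \<inter> space borel \<in> sets borel"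
      by (rule measurable_sets[OF measurable_shift]) (use sets in \<open>simp add: A_def\<close>)
    then show ?thesis unfolding A_shift[of i] by (simp add: sets_\<mu> vimage_def)
  qed
  have eq: "prob (A i) = prob (A 0)" for i
    using emeasure_shift[of "A 0" i] A_sets[of 0] A_shift[of i] by (simp add: sets_\<mu> measure_def)
  have "real N * prob (A 0) \<le> 1" for N :: nat
  proof -
    have "disjoint_family_on A {0..<int N}"
      unfolding disjoint_family_on_def A_def using unique by blast
    then have "prob (\<Union>i\<in>{0..<int N}. A i) = (\<Sum>i\<in>{0..<int N}. prob (A i))"
      using A_sets by (intro finite_measure_finite_Union) auto
    also have "\<dots> = (\<Sum>i\<in>{0..<int N}. prob (A 0))" by (intro sum.cong eq refl)
    also have "\<dots> = real N * prob (A 0)" by simp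
    finally show ?thesis using prob_le_1 by metis
  qed
  then have "prob (A 0) = 0"
    by (metis measure_nonneg less_eq_real_def reals_Archimedean3 not_le)
  then have "A i \<in> null_sets \<mu>" for i
    using A_sets eq[of i] by (intro null_setsI) (simp_all add: emeasure_eq_measure)
  then have "AE n in \<mu>. n \<notin> A i" for i using A_sets by (simp add: AE_iff_null_sets)
  then have "AE n in \<mu>. \<forall>i. n \<notin> A i" by (simp add: AE_all_countable)
  then show ?thesis by (simp add: A_def)
qed

end

section \<open>Existence and growth of the hole enumeration\<close>

lemma sets_all_local:
  fixes P :: "int \<Rightarrow> (int \<Rightarrow> 'a::{countable,second_countable_topology,t2_space}) \<Rightarrow> bool"
  assumes "\<And>j x y. agree \<bar>j\<bar> x y \<Longrightarrow> P j x = P j y"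
  shows "{x. \<forall>j. P j x} \<in> sets borel"
proof -
  have "{x \<in> space borel. \<forall>j. P j x} \<in> sets borel"
    by (rule sets.sets_Collect_countable_All) (use local_sets[OF assms] in simp)
  then show ?thesis by simp
qed

text \<open>Almost surely there is neither a last nor a first hole, since each would be unique; so
  one hole entails infinitely many on both sides. The full configuration has no enumeration and is
  set apart.\<close>

lemma AE_hole_enum:
  assumes "TIS fssep_kernel \<mu>"
  shows "AE \<eta> in \<mu>. (\<forall>i. \<eta> i) \<or> (\<exists>p. hole_enum \<eta> p)"
proof -
  interpret tis_dynamics fssep_step \<mu> by (rule tis_dynamics_fssep[OF assms])
  have last: "AE \<eta> in \<mu>. \<forall>i. \<not> (\<forall>j. (i < j \<longrightarrow> \<eta> j) \<and> (j = i \<longrightarrow> \<not> \<eta> i))"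
  proof (rule AE_no_unique_site[where P = "\<lambda>\<eta> i. \<forall>j. (i < j \<longrightarrow> \<eta> j) \<and> (j = i \<longrightarrow> \<not> \<eta> i)"])
    show "{\<eta> :: int \<Rightarrow> bool. \<forall>j. (0 < j \<longrightarrow> \<eta> j) \<and> (j = 0 \<longrightarrow> \<not> \<eta> 0)} \<in> sets borel"
      by (rule sets_all_local) (auto simp: agree_def)
    show "(\<forall>j. (i < j \<longrightarrow> \<eta> (j + k)) \<and> (j = i \<longrightarrow> \<not> \<eta> (i + k))) =
        (\<forall>j. (i + k < j \<longrightarrow> \<eta> j) \<and> (j = i + k \<longrightarrow> \<not> \<eta> (i + k)))" for \<eta> :: "int \<Rightarrow> bool" and i k
      by (metis add_less_cancel_right diff_add_cancel)
    show "i = j" if "\<forall>l. (i < l \<longrightarrow> \<eta> l) \<and> (l = i \<longrightarrow> \<not> \<eta> i)"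
      "\<forall>l. (j < l \<longrightarrow> \<eta> l) \<and> (l = j \<longrightarrow> \<not> \<eta> j)" for \<eta> and i j :: int
      using that by (cases i j rule: linorder_cases) auto
  qed
  have first: "AE \<eta> in \<mu>. \<forall>i. \<not> (\<forall>j. (j < i \<longrightarrow> \<eta> j) \<and> (j = i \<longrightarrow> \<not> \<eta> i))"
  proof (rule AE_no_unique_site[where P = "\<lambda>\<eta> i. \<forall>j. (j < i \<longrightarrow> \<eta> j) \<and> (j = i \<longrightarrow> \<not> \<eta> i)"])
    show "{\<eta> :: int \<Rightarrow> bool. \<forall>j. (j < 0 \<longrightarrow> \<eta> j) \<and> (j = 0 \<longrightarrow> \<not> \<eta> 0)} \<in> sets borel"
      by (rule sets_all_local) (auto simp: agree_def)
    show "(\<forall>j. (j < i \<longrightarrow> \<eta> (j + k)) \<and> (j = i \<longrightarrow> \<not> \<eta> (i + k))) =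
        (\<forall>j. (j < i + k \<longrightarrow> \<eta> j) \<and> (j = i + k \<longrightarrow> \<not> \<eta> (i + k)))" for \<eta> :: "int \<Rightarrow> bool" and i k
      by (metis add_less_cancel_right diff_add_cancel)
    show "i = j" if "\<forall>l. (l < i \<longrightarrow> \<eta> l) \<and> (l = i \<longrightarrow> \<not> \<eta> i)"
      "\<forall>l. (l < j \<longrightarrow> \<eta> l) \<and> (l = j \<longrightarrow> \<not> \<eta> j)" for \<eta> and i j :: int
      using that by (cases i j rule: linorder_cases) auto
  qed
  have unbounded: "\<exists>i>m. \<not> \<eta> i"
    if no_last: "\<forall>i. \<not> (\<forall>j. (i < j \<longrightarrow> \<eta> j) \<and> (j = i \<longrightarrow> \<not> \<eta> i))" and hole: "\<not> \<eta> l"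
    for \<eta> :: "int \<Rightarrow> bool" and l m
  proof (rule ccontr)
    assume none: "\<not> ?thesis"
    with hole have "l < m + 1" by (metis not_less zless_add1_eq zle_add1_eq_le)
    then obtain x where "x < m + 1" "\<not> \<eta> x" "\<forall>y. x < y \<and> y < m + 1 \<longrightarrow> \<not> \<not> \<eta> y"
      using ex_greatest_int[of "\<lambda>i. \<not> \<eta> i" l "m + 1"] hole by blast
    with none have "\<forall>j. (x < j \<longrightarrow> \<eta> j) \<and> (j = x \<longrightarrow> \<not> \<eta> x)" by (metis not_less zle_add1_eq_le)
    with no_last show False by blast
  qed
  show ?thesis
    using last first
  proof eventually_elim
    case (elim \<eta>)
    show ?case
    proof (cases "\<forall>i. \<eta> i")
      case False
      then obtain l where l: "\<not> \<eta> l" by blast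
      have "\<forall>i. \<not> (\<forall>j. (i < j \<longrightarrow> reflect \<eta> j) \<and> (j = i \<longrightarrow> \<not> reflect \<eta> i))"
      proof
        fix i
        obtain j where "j < - i \<and> \<not> \<eta> j \<or> j = - i \<and> \<eta> (- i)" using elim(2) by blast
        then show "\<not> (\<forall>j. (i < j \<longrightarrow> reflect \<eta> j) \<and> (j = i \<longrightarrow> \<not> reflect \<eta> i))"
          by (intro notI) (drule spec[of _ "- j"], auto simp: reflect_def)
      qed
      then have "\<exists>i>- m. \<not> reflect \<eta> i" for m
        using unbounded[of "reflect \<eta>" "- l" "- m"] l by (simp add: reflect_def)
      then have "\<exists>i<m. \<not> \<eta> i" for m unfolding reflect_def by (metis minus_less_iff)
      with unbounded[OF elim(1) l] show ?thesis by (intro disjI2 hole_enum_exists)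
    qed simp
  qed
qed

lemma config_density_reflect:
  assumes "config_density occ \<eta> \<rho>"
  shows "config_density occ (reflect \<eta>) \<rho>"
proof -
  have "(\<Sum>i = 1..int N. occ (reflect \<eta> i)) = (\<Sum>i = - int N..- 1. occ (\<eta> i))"
    "(\<Sum>i = - int N..- 1. occ (reflect \<eta> i)) = (\<Sum>i = 1..int N. occ (\<eta> i))" for N
    by (rule sum.reindex_bij_witness[of _ uminus uminus]; auto simp: reflect_def)+
  with assms show ?thesis by (simp add: config_density_def)
qed

text \<open>For \<open>N = p k\<close> the sites from 1 to \<open>N\<close> contain the holes with
  indices \<open>k1\<close> to \<open>k\<close>, while the density leaves room for at most
  \<open>(1 - c) * N\<close> holes, with \<open>c > 1 / 2\<close>. Hence \<open>2 * k\<close> falls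
  behind \<open>N\<close> linearly.\<close>

lemma hole_enum_growth:
  assumes p: "hole_enum \<eta> p" and dens: "config_density of_bool \<eta> \<rho>" "1 / 2 < \<rho>"
  shows "\<exists>K. \<forall>k\<ge>K. C < p k - 2 * k"
proof -
  have mono: "strict_mono p" using p by (simp add: hole_enum_def)
  have grow: "p k + int m \<le> p (k + int m)" for k m
  proof (induction m)
    case (Suc m)
    have e: "k + int (Suc m) = k + int m + 1" by simp
    show ?case using Suc hole_enum_next[OF p, of "k + int m"] unfolding e by linarith
  qed simp
  have grow': "p j + (k - j) \<le> p k" if "j \<le> k" for j k using grow[of j "nat (k - j)"] that by simp
  \<comment> \<open>Holes advance by at least one site per index, so hole \<open>k1\<close> lies in
    the range counted by the density.\<close>
  define k1 where "k1 = \<bar>p 0\<bar> + 1"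
  have k1: "1 \<le> p k1" using grow'[of 0 k1] by (simp add: k1_def)
  define c where "c = (1 / 2 + \<rho>) / 2"
  have c: "1 / 2 < c" "c < \<rho>" using dens(2) by (auto simp: c_def)
  obtain K1 where K1: "\<forall>N\<ge>K1. c * real N \<le> (\<Sum>i = 1..int N. of_bool (\<eta> i))"
    using config_density_lower(1)[OF dens(1) c(2)] by blast
  obtain L :: nat where L: "\<forall>N\<ge>L. real_of_int C < (2 * c - 1) * real N - real_of_int (2 * k1)"
    using eventually_linear_above[of "2 * c - 1"] c by fastforce
  have "C < p k - 2 * k" if k: "k1 + int (max K1 L) \<le> k" for k
  proof -
    define N where "N = nat (p k)"
    have kN: "k - k1 + 1 \<le> p k" using grow'[of k1 k] k k1 by simp
    then have pk: "p k = int N" and N: "K1 \<le> N" "L \<le> N" using k by (auto simp: N_def)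
    have sub: "p ` {k1..k} \<subseteq> {1..int N}"
      using k1 mono unfolding pk[symmetric] by (force simp: strict_mono_less_eq intro: order_trans)
    have "(\<Sum>i = 1..int N. of_bool (\<eta> i) :: real) = (\<Sum>i \<in> {1..int N} - p ` {k1..k}. of_bool (\<eta> i))"
      by (rule sum.mono_neutral_right) (use sub hole_enum_hole[OF p] in auto)
    also have "\<dots> \<le> (\<Sum>i \<in> {1..int N} - p ` {k1..k}. 1)" by (intro sum_mono) simp
    also have "\<dots> = real (card ({1..int N} - p ` {k1..k}))" by simp
    also have "card ({1..int N} - p ` {k1..k}) = N - nat (k - k1 + 1)"
      using sub mono by (subst card_Diff_subset) (auto simp: card_image strict_mono_on_imp_inj_on strict_mono_imp_inj_on inj_on_subset)
    also have "real (N - nat (k - k1 + 1)) = real N - real_of_int (k - k1 + 1)"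
      using k kN pk by (subst of_nat_diff) (auto simp: nat_le_iff)
    finally have "c * real N \<le> real N - real_of_int (k - k1 + 1)" using K1 N(1) by fastforce
    then have "2 * real_of_int k \<le> 2 * real N - 2 * (c * real N) + real_of_int (2 * k1)" by simp
    moreover have "real_of_int C < (2 * c - 1) * real N - real_of_int (2 * k1)" using L N(2) by blast
    ultimately have "real_of_int C < real_of_int (p k - 2 * k)"
      unfolding pk by (simp add: algebra_simps)
    then show ?thesis by simp
  qed
  then show ?thesis by blast
qed

lemma hole_run_start_shift: "hole_run_start (\<lambda>j. \<eta> (j + k)) i = hole_run_start \<eta> (i + k)"
  by (simp add: hole_run_start_def algebra_simps)

text \<open>Distinct holes carry distinct coins, so every choice of stack coins arises from site
  coins.\<close>

lemma coins_at_holes: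
  assumes "hole_enum \<eta> p"
  shows "\<exists>\<omega>. \<omega>' = (\<lambda>k. \<omega> (p (k + 1)))"
proof -
  have "inj p" using assms by (simp add: hole_enum_def strict_mono_imp_inj_on)
  then show ?thesis by (intro exI[of _ "\<lambda>j. \<omega>' (inv p j - 1)"]) simp
qed

lemma full_step: "(\<forall>i. \<eta> i) \<Longrightarrow> fssep_step \<omega> \<eta> i"
  by (simp add: fssep_step_def jumps_right_def jumps_left_def attempts_right_def attempts_left_def)

text \<open>No measure is put on stack configurations: persistence is proved for site markers under
  \<open>\<mu>\<close> and then carried over, one configuration at a time, to the set
  \<open>S\<close> of stacks of the support.\<close>

lemma fssep_no_frozen_bond:
  assumes "TIS fssep_kernel \<mu>" "has_density of_bool \<mu> \<rho>" "1 / 2 < \<rho>"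
  shows "AE \<eta> in \<mu>. (\<forall>i. \<eta> i) \<or> (\<exists>p. hole_enum \<eta> p \<and> (\<forall>k. \<not> frozen (stacks p) k))"
proof -
  interpret tis_dynamics fssep_step \<mu> by (rule tis_dynamics_fssep[OF assms(1)])
  have loc: "hole_run_start \<eta> 0 = hole_run_start \<eta>' 0" if "agree 4 \<eta> \<eta>'" for \<eta> \<eta>'
    using that by (simp add: hole_run_start_def agree_def)
  have step_start: "\<exists>i. \<bar>i - j\<bar> \<le> 2 \<and> hole_run_start \<eta> i"
    if "(\<forall>i. \<eta> i) \<or> (\<exists>p. hole_enum \<eta> p)" "hole_run_start (fssep_step \<omega> \<eta>) j" for \<eta> \<omega> j
    using that hole_run_start_step full_step by (metis hole_run_start_def)
  have starts: "\<exists>j. \<bar>j - i\<bar> \<le> 2 \<and> hole_run_start (fssep_step \<omega> \<eta>) j"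
    if "\<eta> \<in> support" "hole_run_start \<eta> i" for \<eta> \<omega> i
  proof (rule marker_persists[where M = hole_run_start and r = 4, OF loc _ _ _ that])
    show "\<bar>i - j\<bar> > 2 * 2" if "hole_run_start \<eta> i" "hole_run_start \<eta> j" "i \<noteq> j" for \<eta> i j
      using hole_run_start_spacing[OF that] by simp
    show "AE \<eta> in \<mu>. \<forall>\<omega> j. hole_run_start (fssep_step \<omega> \<eta>) j \<longrightarrow> (\<exists>i. \<bar>i - j\<bar> \<le> 2 \<and> hole_run_start \<eta> i)"
      using AE_hole_enum[OF assms(1)] by eventually_elim (use step_start in blast)
  qed (simp_all add: hole_run_start_shift)
  have ends: "\<exists>j. \<bar>j - i\<bar> \<le> 2 \<and> hole_run_start (reflect (fssep_step \<omega> \<eta>)) j"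
    if n: "\<eta> \<in> support" "hole_run_start (reflect \<eta>) i" for \<eta> \<omega> i
  proof -
    have "\<exists>j. \<bar>j - (- i)\<bar> \<le> 2 \<and> hole_run_start (reflect (fssep_step \<omega> \<eta>)) (- j)"
    proof (rule marker_persists[where M = "\<lambda>\<eta> i. hole_run_start (reflect \<eta>) (- i)" and r = 4, OF _ _ _ _ n(1)])
      show "hole_run_start (reflect \<eta>) (- 0) = hole_run_start (reflect \<eta>') (- 0)"
        if "agree 4 \<eta> \<eta>'" for \<eta> \<eta>' :: "int \<Rightarrow> bool"
        using loc[OF agree_reflect[OF that]] by simp
      show "hole_run_start (reflect (\<lambda>j. \<eta> (j + k))) (- i) = hole_run_start (reflect \<eta>) (- (i + k))" for \<eta> i k
        using hole_run_start_shift[of "reflect \<eta>" "- k" "- i"] by (simp add: reflect_shift)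
      show "\<bar>i - j\<bar> > 2 * 2"
        if "hole_run_start (reflect \<eta>) (- i)" "hole_run_start (reflect \<eta>) (- j)" "i \<noteq> j" for \<eta> i j
        using hole_run_start_spacing[OF that(1,2)] that(3) by linarith
      show "AE \<eta> in \<mu>. \<forall>\<omega> j. hole_run_start (reflect (fssep_step \<omega> \<eta>)) (- j) \<longrightarrow>
          (\<exists>i. \<bar>i - j\<bar> \<le> 2 \<and> hole_run_start (reflect \<eta>) (- i))"
        using AE_hole_enum[OF assms(1)]
      proof eventually_elim
        case (elim \<eta>)
        then have g: "(\<forall>i. reflect \<eta> i) \<or> (\<exists>p. hole_enum (reflect \<eta>) p)"
          using hole_enum_reflect(1) by (auto simp: reflect_def)
        show ?case
        proof (intro allI impI)
          fix \<omega> j assume "hole_run_start (reflect (fssep_step \<omega> \<eta>)) (- j)"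
          then obtain i where "\<bar>i - (- j)\<bar> \<le> 2" "hole_run_start (reflect \<eta>) i"
            using step_start[OF g] unfolding fssep_step_reflect by blast
          then show "\<exists>i. \<bar>i - j\<bar> \<le> 2 \<and> hole_run_start (reflect \<eta>) (- i)"
            by (intro exI[of _ "- i"]) auto
        qed
      qed
    qed (use n in simp)
    then obtain j where "\<bar>j - (- i)\<bar> \<le> 2" "hole_run_start (reflect (fssep_step \<omega> \<eta>)) (- j)" by blast
    then show ?thesis by (intro exI[of _ "- j"]) auto
  qed
  have zeros: "hole_inner_zero (fssep_step \<omega> \<eta>) i" if n: "\<eta> \<in> support" "hole_inner_zero \<eta> i" for \<eta> \<omega> i
  proof -
    have "\<exists>j. \<bar>j - i\<bar> \<le> 0 \<and> hole_inner_zero (fssep_step \<omega> \<eta>) j"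
    proof (rule marker_persists[where M = hole_inner_zero and r = 3, OF _ _ _ _ n])
      show "hole_inner_zero \<eta> 0 = hole_inner_zero \<eta>' 0" if "agree 3 \<eta> \<eta>'" for \<eta> \<eta>'
        using that by (simp add: hole_inner_zero_def agree_def)
      show "AE \<eta> in \<mu>. \<forall>\<omega> j. hole_inner_zero (fssep_step \<omega> \<eta>) j \<longrightarrow> (\<exists>i. \<bar>i - j\<bar> \<le> 0 \<and> hole_inner_zero \<eta> i)"
        using AE_support AE_hole_enum[OF assms(1)]
      proof eventually_elim
        case (elim \<eta>)
        have "hole_inner_zero \<eta> j" if j: "hole_inner_zero (fssep_step \<omega> \<eta>) j" for \<omega> j
        proof -
          from elim(2) show ?thesis
          proof
            assume "\<forall>i. \<eta> i"
            with j full_step[of \<eta>] show ?thesis by (simp add: hole_inner_zero_def)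
          next
            assume "\<exists>p. hole_enum \<eta> p"
            then obtain p where "hole_enum \<eta> p" by blast
            from this starts[OF elim(1)] j show ?thesis by (rule hole_inner_zero_step)
          qed
        qed
        then show ?case by auto
      qed
    qed (auto simp: hole_inner_zero_def algebra_simps)
    then show ?thesis by simp
  qed
  define S where "S = {stacks p |p. \<exists>\<eta>\<in>support. hole_enum \<eta> p}"
  have S: "\<exists>p \<eta> \<omega>. \<eta> \<in> support \<and> hole_enum \<eta> p \<and> n = stacks p \<and>
      ssm_step \<omega>' n = stacks (moved_holes \<omega> p)" if n: "n \<in> S" for n \<omega>'
  proof -
    obtain p \<eta> where p: "\<eta> \<in> support" "hole_enum \<eta> p" "n = stacks p" using n by (auto simp: S_def)
    obtain \<omega> where "\<omega>' = (\<lambda>k. \<omega> (p (k + 1)))" using coins_at_holes[OF p(2)] by blast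
    with p hole_enum_step(2)[OF p(2), of \<omega>] show ?thesis by metis
  qed
  have S_step: "ssm_step \<omega>' n \<in> S" if n: "n \<in> S" for n \<omega>'
  proof -
    obtain p \<eta> \<omega> where *: "\<eta> \<in> support" "hole_enum \<eta> p" "n = stacks p"
      "ssm_step \<omega>' n = stacks (moved_holes \<omega> p)" using S[OF n] by blast
    then show ?thesis
      unfolding S_def using hole_enum_step(1)[OF *(2), of \<omega>] support_step[OF *(1), of \<omega>] by auto
  qed
  have S_starts: "\<exists>j. \<bar>j - i\<bar> \<le> 1 \<and> run_start (ssm_step \<omega>' n) j"
    if n: "n \<in> S" and i: "run_start n i" for n \<omega>' i
  proof -
    obtain p \<eta> \<omega> where *: "\<eta> \<in> support" "hole_enum \<eta> p" "n = stacks p"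
      "ssm_step \<omega>' n = stacks (moved_holes \<omega> p)" using S[OF n] by blast
    show ?thesis
      unfolding *(4)
      by (rule run_start_persists[OF *(2) _ i[unfolded *(3)]]) (rule starts[OF *(1)])
  qed
  have S_ends: "\<exists>j. \<bar>j - i\<bar> \<le> 1 \<and> run_start (reflect (ssm_step \<omega>' n)) j"
    if n: "n \<in> S" and i: "run_start (reflect n) i" for n \<omega>' i
  proof -
    obtain p \<eta> \<omega> where *: "\<eta> \<in> support" "hole_enum \<eta> p" "n = stacks p"
      "ssm_step \<omega>' n = stacks (moved_holes \<omega> p)" using S[OF n] by blast
    note refl = hole_enum_reflect[OF *(2)]
    \<comment> \<open>Right ends are starts of the mirror image, enumerated by \<open>q\<close>;
      mirroring commutes with the step once the coins are negated.\<close>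
    define q where "q k = - p (1 - k)" for k
    have q: "hole_enum (reflect \<eta>) q" "stacks q = reflect n"
      using refl by (simp_all add: q_def[abs_def] *(3))
    have st: "\<exists>r. \<bar>r - l\<bar> \<le> 2 \<and> hole_run_start (fssep_step (\<lambda>i. \<not> \<omega> (- i)) (reflect \<eta>)) r"
      if "hole_run_start (reflect \<eta>) l" for l
      using ends[OF *(1) that, of \<omega>] unfolding fssep_step_reflect .
    have "reflect (ssm_step \<omega>' n) = stacks (moved_holes (\<lambda>i. \<not> \<omega> (- i)) q)"
    proof -
      have "moved_holes (\<lambda>i. \<not> \<omega> (- i)) q = (\<lambda>k. - moved_holes \<omega> p (1 - k))"
      proof
        fix k :: int
        have e: "(\<lambda>k. \<not> \<omega> (- q (k + 1))) = (\<lambda>k. \<not> (\<lambda>k. \<omega> (p (k + 1))) (- k - 1))"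
          by (simp add: q_def fun_eq_iff)
        have "ssm_current (\<lambda>k. \<not> \<omega> (- q (k + 1))) (reflect (stacks p)) (k - 1) =
            - ssm_current (\<lambda>k. \<omega> (p (k + 1))) (stacks p) (- (k - 1) - 1)"
          unfolding e by (rule current_reflect[of "\<lambda>k. \<omega> (p (k + 1))" "stacks p" "k - 1"])
        then show "moved_holes (\<lambda>i. \<not> \<omega> (- i)) q k = - moved_holes \<omega> p (1 - k)"
          unfolding moved_holes_def q(2) *(3) by (simp add: q_def)
      qed
      then show ?thesis
        unfolding *(4) using hole_enum_reflect(2)[OF hole_enum_step(1)[OF *(2), of \<omega>]] by simp
    qed
    then show ?thesis using run_start_persists[OF q(1) st] i unfolding q(2)[symmetric] by metis
  qed
  have S_zeros: "inner_zero (ssm_step \<omega>' n) i" if n: "n \<in> S" and i: "inner_zero n i" for n \<omega>' i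
  proof -
    obtain p \<eta> \<omega> where *: "\<eta> \<in> support" "hole_enum \<eta> p" "n = stacks p"
      "ssm_step \<omega>' n = stacks (moved_holes \<omega> p)" using S[OF n] by blast
    show ?thesis
      unfolding *(4)
      by (rule inner_zero_persists[OF *(2) _ i[unfolded *(3)]]) (rule zeros[OF *(1)])
  qed
  show ?thesis
    using AE_hole_enum[OF assms(1)] AE_support assms(2)[unfolded has_density_def]
  proof eventually_elim
    case (elim \<eta>)
    have "\<forall>k. \<not> frozen (stacks p) k" if p: "hole_enum \<eta> p" for p
    proof
      fix k
      \<comment> \<open>Holes around a stack of size \<open>m\<close> are \<open>m + 1\<close> sites
        apart; subtracting 2 per index leaves the increment \<open>m - 1\<close>.\<close>
      have "is_height (stacks p) (\<lambda>k. p (k + 1) - 2 * k)"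
        unfolding is_height_def
      proof
        fix k
        show "p (k + 1) - 2 * k = p (k - 1 + 1) - 2 * (k - 1) + int (stacks p k) - 1"
          using hole_enum_next[OF p, of k] by simp
      qed
      moreover have "\<exists>K. \<forall>k\<ge>K. C < p (k + 1) - 2 * k" for C
      proof -
        obtain K where "\<forall>k\<ge>K. C < p k - 2 * k" using hole_enum_growth[OF p elim(3) assms(3)] by blast
        then have "\<forall>k\<ge>K. C < p (k + 1) - 2 * k" by (smt (verit))
        then show ?thesis by blast
      qed
      moreover have "\<exists>K. \<forall>k\<le>K. p (k + 1) - 2 * k < C" for C
      proof -
        obtain K where K: "\<forall>k\<ge>K. - C < - p (1 - k) - 2 * k"
          using hole_enum_growth[OF hole_enum_reflect(1)[OF p] config_density_reflect[OF elim(3)] assms(3)]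
          by blast
        have "p (k + 1) - 2 * k < C" if "k \<le> - K" for k
          using K[rule_format, of "- k"] that by (simp add: add.commute)
        then show ?thesis by blast
      qed
      moreover have "stacks p \<in> S" using p elim(2) by (auto simp: S_def)
      ultimately show "\<not> frozen (stacks p) k"
        by (intro no_frozen_bond[of S, OF S_step S_starts S_ends S_zeros])
    qed
    with elim(1) show ?case by blast
  qed
qed

text \<open>Each forbidden string contains a hole with no pair of particles directly on either side:
  the middle site of \<open>000\<close> and \<open>01010\<close>, the third of \<open>0100\<close>,
  the second of \<open>0010\<close>.\<close>

lemma in_H:
  assumes "\<And>q. \<not> \<eta> q \<Longrightarrow> \<eta> (q - 1) \<and> \<eta> (q - 2) \<or> \<eta> (q + 1) \<and> \<eta> (q + 2)"
  shows "\<eta> \<in> H"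
proof -
  have "\<not> contains_substring \<eta> w" if "w \<in> {[0,0,0], [0,1,0,0], [0,0,1,0], [0,1,0,1,0]}" for w
  proof
    assume "contains_substring \<eta> w"
    then obtain i where i: "\<And>j. j < length w \<Longrightarrow> of_bool (\<eta> (i + int j)) = w ! j"
      by (auto simp: contains_substring_def)
    from that show False
      using i[of 0] i[of 1] i[of 2] i[of 3] i[of 4] assms[of "i + 1"] assms[of "i + 2"]
      by (auto simp: algebra_simps)
  qed
  then show ?thesis by (simp add: H_def)
qed

theorem theorem5p1:
  shows "(\<forall>\<mu> \<rho>\<^sub>h. TIS ssm_kernel \<mu> \<longrightarrow> has_density real \<mu> \<rho>\<^sub>h \<longrightarrow> \<rho>\<^sub>h > 1 \<longrightarrow> supported_on \<mu> X_hat_star)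
       \<and> (\<forall>\<mu> \<rho>. TIS fssep_kernel \<mu> \<longrightarrow> has_density of_bool \<mu> \<rho> \<longrightarrow> \<rho> > 1/2 \<longrightarrow> supported_on \<mu> H)"
proof (intro conjI allI impI)
  fix \<mu> :: "(int \<Rightarrow> nat) measure" and \<rho> :: real
  assume "TIS ssm_kernel \<mu>" "has_density real \<mu> \<rho>" "1 < \<rho>"
  then show "supported_on \<mu> X_hat_star"
    using ssm_no_frozen_bond by (simp add: supported_on_def X_hat_star_def frozen_def)
next
  fix \<mu> :: "(int \<Rightarrow> bool) measure" and \<rho> :: real
  assume "TIS fssep_kernel \<mu>" "has_density of_bool \<mu> \<rho>" "1 / 2 < \<rho>"
  from fssep_no_frozen_bond[OF this] show "supported_on \<mu> H"
    unfolding supported_on_def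
  proof eventually_elim
    case (elim \<eta>)
    show ?case
    proof (rule in_H)
      fix q assume q: "\<not> \<eta> q"
      \<comment> \<open>The hole \<open>q\<close> excludes the full configuration.\<close>
      with elim obtain p where p: "hole_enum \<eta> p" "\<forall>k. \<not> frozen (stacks p) k" by blast
      obtain k where "q = p (k + 1)" using hole_enum_ex[OF p(1) q] by blast
      with p(2) tall_before_hole[OF p(1), of k] tall_after_hole[OF p(1), of "k + 1"]
      show "\<eta> (q - 1) \<and> \<eta> (q - 2) \<or> \<eta> (q + 1) \<and> \<eta> (q + 2)" by (auto simp: frozen_def)
    qed
  qed
qed

end
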